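(* Let $r\in\mathbb{N}$ and let $\mathbf{N}=(N_1,\ldots,N_r)$ be a tuple of normal subgroups of a group $G$. If $\gamma_r\{\mathbf{N}\}$ is finite of order $m$, then the subgroup $\gamma_r(\mathbf{N})$ is also finite, of $(m,r)$-bounded order.
   Context: $\mathbb{N}$ denotes the positive integers. For a word $w=w(x_1,\ldots,x_r)$ and a tuple $\mathbf{N}=(N_1,\ldots,N_r)$ of subgroups of $G$, $w\{\mathbf{N}\}=\{w(g_1,\ldots,g_r)\mid g_i\in N_i\}$ and $w(\mathbf{N})=\langle w\{\mathbf{N}\}\rangle$. Commutators are $[x,y]=x^{-1}y^{-1}xy$, and $\gamma_r(x_1,\ldots,x_r)=[x_1,\ldots,x_r]=[[x_1,\ldots,x_{r-1}],x_r]$, with $\gamma_1=x_1$. "$(m,r)$-bounded" means bounded by a function depending only on $m$ and $r$ (and not on $G$ or the $N_i$). *)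

theory Defs
  imports "HOL-Algebra.Coset" "HOL-Algebra.Generated_Groups"
begin

definition comm :: "('a, 'b) monoid_scheme \<Rightarrow> 'a \<Rightarrow> 'a \<Rightarrow> 'a" where
  "comm G x y = inv\<^bsub>G\<^esub> x \<otimes>\<^bsub>G\<^esub> inv\<^bsub>G\<^esub> y \<otimes>\<^bsub>G\<^esub> x \<otimes>\<^bsub>G\<^esub> y"

(* Tuples (g_1, ..., g_r) are functions on nat, of which only the values at 1, ..., r matter.
   The value for r = 0 is a dummy. *)
fun gamma :: "('a, 'b) monoid_scheme \<Rightarrow> nat \<Rightarrow> (nat \<Rightarrow> 'a) \<Rightarrow> 'a" where
  "gamma G 0 g = \<one>\<^bsub>G\<^esub>"
| "gamma G (Suc 0) g = g 1"
| "gamma G (Suc (Suc n)) g = comm G (gamma G (Suc n) g) (g (Suc (Suc n)))"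

(* The set w{N} for a word w in r variables, represented by its evaluation map. *)
definition word_values :: "nat \<Rightarrow> ((nat \<Rightarrow> 'a) \<Rightarrow> 'a) \<Rightarrow> (nat \<Rightarrow> 'a set) \<Rightarrow> 'a set" where
  "word_values r w N = {w g | g. \<forall>i\<in>{1..r}. g i \<in> N i}"

(* The subgroup w(N). *)
definition verbal_subgroup ::
  "('a, 'b) monoid_scheme \<Rightarrow> nat \<Rightarrow> ((nat \<Rightarrow> 'a) \<Rightarrow> 'a) \<Rightarrow> (nat \<Rightarrow> 'a set) \<Rightarrow> 'a set" where
  "verbal_subgroup G r w N = generate G (word_values r w N)"

(* An (m,r)-bound must not depend on the group, hence not on the type of its elements either.
   A formula "EX f. ALL G :: 'a monoid. ..." would allow f to vary with 'a, so the bound is a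
   constant, whose type involves no 'a: an arbitrarily chosen bound for the groups whose
   elements are natural numbers. Should no such bound exist, the choice is an unspecified number,
   which then is not a bound for these groups.

   Restricting the choice to these groups loses nothing. If gamma_r{N} is finite, pick for each
   of its elements a tuple mapped to it, and let H be the subgroup generated by the entries of
   these finitely many tuples. The subgroups N_i \<inter> H are normal in the countable group H and yield
   the same set gamma_r{N}, hence the same gamma_r(N). *)
definition gamma_order_bound :: "nat \<Rightarrow> nat \<Rightarrow> nat" where
  "gamma_order_bound m r = (SOME b. \<forall>(G :: nat monoid) N.
     group G \<longrightarrow> (\<forall>i\<in>{1..r}. N i \<lhd> G) \<longrightarrow>
     finite (word_values r (gamma G r) N) \<longrightarrow> card (word_values r (gamma G r) N) = m \<longrightarrow>
       finite (verbal_subgroup G r (gamma G r) N) \<and>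
       card (verbal_subgroup G r (gamma G r) N) \<le> b)"

end

theory Submission
  imports Defs "HOL-Library.Countable_Set"
begin

text \<open>
  Write \<open>X = \<gamma>\<^sub>r{N}\<close>, a set closed under conjugation, and \<open>L = \<langle>X\<rangle>\<close>. By Dietzmann's lemma it suffices to bound
  the orders of the elements of \<open>X\<close>. A variant of the collection argument behind that lemma bounds
  the orders of the commutators of elements of \<open>X\<close>, so \<open>L'\<close> has bounded order, and one may pass to
  \<open>G/L'\<close> and assume that \<open>L\<close> is abelian.

  For smaller tuples \<open>M\<close> of normal subgroups, the word \<open>\<gamma>\<^sub>r\<close> is linear on \<open>M\<close> in the position \<open>i\<close> modulo the
  subgroups \<open>\<gamma>\<^sub>r(M')\<close>, where \<open>M'\<close> arises from \<open>M\<close> by replacing an entry \<open>M\<^sub>p\<close> by \<open>[M\<^sub>p, M\<^sub>i]\<close> if \<open>p < i\<close> and by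
  \<open>[M\<^sub>1, \<dots>, M\<^sub>p]\<close> if \<open>p > i\<close>. If these \<open>\<gamma>\<^sub>r(M')\<close> have bounded exponent, then so has \<open>\<gamma>\<^sub>r(M)\<close>: among the powers
  of the \<open>i\<close>-th entry two give the same value in \<open>X\<close>. Choosing \<open>i\<close> suitably, one reaches after boundedly many steps
  tuples with an entry inside \<open>L\<close>, where \<open>\<gamma>\<^sub>r\<close> is truly linear.

  The bound obtained does not depend on the type of the group elements, and so it witnesses that
  \<^const>\<open>gamma_order_bound\<close> is a bound for the groups on the natural numbers; every other group is handled
  through a countable subgroup.
\<close>

section \<open>Commutator calculus\<close>

context group
begin

lemma inv_cancel_left [simp]:
  "x \<in> carrier G \<Longrightarrow> y \<in> carrier G \<Longrightarrow> inv x \<otimes> (x \<otimes> y) = y"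
  "x \<in> carrier G \<Longrightarrow> y \<in> carrier G \<Longrightarrow> x \<otimes> (inv x \<otimes> y) = y"
  by (simp_all flip: m_assoc)

lemma comm_closed [simp, intro]:
  "x \<in> carrier G \<Longrightarrow> y \<in> carrier G \<Longrightarrow> comm G x y \<in> carrier G"
  by (simp add: comm_def)

lemma comm_eq_one_iff:
  assumes "x \<in> carrier G" "y \<in> carrier G"
  shows "comm G x y = \<one> \<longleftrightarrow> x \<otimes> y = y \<otimes> x"
proof -
  have "comm G x y = inv (y \<otimes> x) \<otimes> (x \<otimes> y)"
    using assms by (simp add: comm_def inv_mult_group m_assoc)
  then show ?thesis
    using assms by (metis inv_equality inv_inv inv_closed l_inv m_closed)
qed

lemma inv_comm:
  "x \<in> carrier G \<Longrightarrow> y \<in> carrier G \<Longrightarrow> inv (comm G x y) = comm G y x"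
  by (simp add: comm_def inv_mult_group m_assoc)

lemma comm_conj:
  assumes "x \<in> carrier G" "y \<in> carrier G" "z \<in> carrier G"
  shows "z \<otimes> comm G x y \<otimes> inv z = comm G (z \<otimes> x \<otimes> inv z) (z \<otimes> y \<otimes> inv z)"
  using assms by (simp add: comm_def inv_mult_group m_assoc)

lemma comm_mult_left:
  assumes "x \<in> carrier G" "y \<in> carrier G" "z \<in> carrier G"
  shows "comm G (x \<otimes> y) z = inv y \<otimes> comm G x z \<otimes> y \<otimes> comm G y z"
  using assms by (simp add: comm_def inv_mult_group m_assoc)

lemma comm_mult_right:
  assumes "x \<in> carrier G" "y \<in> carrier G" "z \<in> carrier G"
  shows "comm G x (y \<otimes> z) = comm G x z \<otimes> (inv z \<otimes> comm G x y \<otimes> z)"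
  using assms by (simp add: comm_def inv_mult_group m_assoc)

lemma comm_inv_left:
  assumes "x \<in> carrier G" "y \<in> carrier G"
  shows "comm G (inv x) y = x \<otimes> comm G y x \<otimes> inv x"
  using assms by (simp add: comm_def inv_mult_group m_assoc)

text \<open>Expanding all commutators makes everything cancel freely: this is the Hall-Witt identity
  for the convention \<open>[x, y] = x^-1 y^-1 x y\<close>.\<close>

lemma hall_witt:
  assumes "x \<in> carrier G" "y \<in> carrier G" "z \<in> carrier G"
  shows "(inv y \<otimes> comm G (comm G x (inv y)) z \<otimes> y) \<otimes>
    (inv z \<otimes> comm G (comm G y (inv z)) x \<otimes> z) \<otimes>
    (inv x \<otimes> comm G (comm G z (inv x)) y \<otimes> x) = \<one>"
  using assms by (simp add: comm_def inv_mult_group m_assoc)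

lemma group_hom_Mod: "N \<lhd> G \<Longrightarrow> group_hom G (G Mod N) ((#>) N)"
  by (simp add: group_hom_def group_hom_axioms_def group_axioms
      normal.factorgroup_is_group normal.r_coset_hom_Mod)

lemma Mod_eq_one_iff:
  assumes "N \<lhd> G" "x \<in> carrier G"
  shows "N #> x = \<one>\<^bsub>G Mod N\<^esub> \<longleftrightarrow> x \<in> N"
proof -
  interpret N: normal N G by fact
  show ?thesis
    using assms N.is_subgroup by (auto simp: FactGroup_def coset_join2 dest: coset_join1)
qed

lemma normal_carrier: "carrier G \<lhd> G"
  by (rule normal_invI) (auto intro: subgroup_self)

lemma normal_subset: "N \<lhd> G \<Longrightarrow> x \<in> N \<Longrightarrow> x \<in> carrier G"
  by (meson normal_imp_subgroup subgroup.mem_carrier)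

lemma normal_comm_left:
  assumes "N \<lhd> G" "x \<in> N" "y \<in> carrier G" shows "comm G x y \<in> N"
proof -
  interpret N: normal N G by fact
  have "comm G x y = inv x \<otimes> (inv y \<otimes> x \<otimes> y)"
    using assms by (simp add: comm_def m_assoc)
  then show ?thesis
    using assms N.inv_op_closed1 by simp
qed

lemma normal_comm_right:
  assumes "N \<lhd> G" "x \<in> carrier G" "y \<in> N" shows "comm G x y \<in> N"
  using assms by (metis inv_comm normal_comm_left normal_subset normal_imp_subgroup subgroup.m_inv_closed)

end

lemma (in group_hom) hom_comm:
  "x \<in> carrier G \<Longrightarrow> y \<in> carrier G \<Longrightarrow> h (comm G x y) = comm H (h x) (h y)"
  by (simp add: comm_def)

text \<open>For normal \<open>P\<close>, this is the preimage of the centralizer of the image of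
  \<open>B\<close> in \<open>G Mod P\<close>. By \<open>le_resid_iff\<close> it is the largest
  candidate for \<open>A\<close> in the condition that \<open>[A, B]\<close> lies in
  \<open>P\<close>, which lets inductions peel off the last entry of a commutator.\<close>

definition resid :: "('a, 'b) monoid_scheme \<Rightarrow> 'a set \<Rightarrow> 'a set \<Rightarrow> 'a set" where
  "resid G P B = {x \<in> carrier G. \<forall>b\<in>B. comm G x b \<in> P}"

definition comm_subgroup :: "('a, 'b) monoid_scheme \<Rightarrow> 'a set \<Rightarrow> 'a set \<Rightarrow> 'a set" where
  "comm_subgroup G A B = generate G {comm G a b | a b. a \<in> A \<and> b \<in> B}"

context group
begin

text \<open>Products are handled by \<open>[x y, b] = [x, b]^y [y, b]\<close>. Conjugating
  \<open>x\<close> amounts to conjugating \<open>b\<close> backwards, and normality of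
  \<open>B\<close> keeps the result in \<open>B\<close>.\<close>

lemma resid_normal:
  assumes "P \<lhd> G" "B \<lhd> G"
  shows "resid G P B \<lhd> G"
proof -
  interpret P: normal P G by fact
  interpret B: normal B G by fact
  show ?thesis
  proof (rule normal_invI)
    show "subgroup (resid G P B) G"
    proof (rule subgroupI)
      show "resid G P B \<subseteq> carrier G" by (auto simp: resid_def)
      have "\<one> \<in> resid G P B"
        by (simp add: resid_def comm_def)
      then show "resid G P B \<noteq> {}" by blast
    next
      fix x assume x: "x \<in> resid G P B"
      have "comm G b x \<in> P" if b: "b \<in> B" for b
      proof -
        have "comm G b x = inv (comm G x b)"
          using x b by (simp add: inv_comm resid_def)
        then show ?thesis using x b by (simp add: resid_def)
      qed
      then show "inv x \<in> resid G P B"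
        using x by (auto simp: resid_def comm_inv_left intro!: P.inv_op_closed2)
    next
      fix x y assume "x \<in> resid G P B" "y \<in> resid G P B"
      then show "x \<otimes> y \<in> resid G P B"
        by (auto simp: resid_def comm_mult_left P.inv_op_closed1)
    qed
  next
    fix x z assume z: "z \<in> carrier G" and x: "x \<in> resid G P B"
    have "comm G (z \<otimes> x \<otimes> inv z) b \<in> P" if b: "b \<in> B" for b
    proof -
      have "comm G (z \<otimes> x \<otimes> inv z) b = z \<otimes> comm G x (inv z \<otimes> b \<otimes> z) \<otimes> inv z"
        using z x b by (simp add: comm_def resid_def inv_mult_group m_assoc)
      then show ?thesis
        using z x b P.inv_op_closed2 B.inv_op_closed1 by (simp add: resid_def)
    qed
    then show "z \<otimes> x \<otimes> inv z \<in> resid G P B"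
      using x z by (simp add: resid_def)
  qed
qed

lemma comm_subgroup_normal:
  assumes "A \<lhd> G" "B \<lhd> G"
  shows "comm_subgroup G A B \<lhd> G"
  unfolding comm_subgroup_def
proof (rule normal_generateI)
  show "{comm G a b |a b. a \<in> A \<and> b \<in> B} \<subseteq> carrier G"
    by (auto dest: normal_subset[OF assms(1)] normal_subset[OF assms(2)])
next
  fix h z assume "h \<in> {comm G a b |a b. a \<in> A \<and> b \<in> B}" and z: "z \<in> carrier G"
  then obtain a b where ab: "h = comm G a b" "a \<in> A" "b \<in> B" by auto
  have "z \<otimes> h \<otimes> inv z = comm G (z \<otimes> a \<otimes> inv z) (z \<otimes> b \<otimes> inv z)"
    unfolding ab(1) by (intro comm_conj z normal_subset[OF assms(1) ab(2)] normal_subset[OF assms(2) ab(3)])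
  moreover have "z \<otimes> a \<otimes> inv z \<in> A" "z \<otimes> b \<otimes> inv z \<in> B"
    using normal.inv_op_closed2[OF assms(1) z ab(2)] normal.inv_op_closed2[OF assms(2) z ab(3)] .
  ultimately show "z \<otimes> h \<otimes> inv z \<in> {comm G a b |a b. a \<in> A \<and> b \<in> B}"
    by auto
qed

lemma comm_in_comm_subgroup: "a \<in> A \<Longrightarrow> b \<in> B \<Longrightarrow> comm G a b \<in> comm_subgroup G A B"
  unfolding comm_subgroup_def by (rule generate.incl) blast

lemma comm_subgroup_le_iff:
  assumes "P \<lhd> G"
  shows "comm_subgroup G A B \<subseteq> P \<longleftrightarrow> (\<forall>a\<in>A. \<forall>b\<in>B. comm G a b \<in> P)"
proof
  show "\<forall>a\<in>A. \<forall>b\<in>B. comm G a b \<in> P" if "comm_subgroup G A B \<subseteq> P"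
    using that comm_in_comm_subgroup[of _ A _ B] by auto
next
  assume "\<forall>a\<in>A. \<forall>b\<in>B. comm G a b \<in> P"
  then show "comm_subgroup G A B \<subseteq> P"
    unfolding comm_subgroup_def
    by (intro generate_subgroup_incl normal_imp_subgroup[OF assms]) auto
qed

lemma comm_subgroup_mono:
  "A \<subseteq> A' \<Longrightarrow> B \<subseteq> B' \<Longrightarrow> comm_subgroup G A B \<subseteq> comm_subgroup G A' B'"
  unfolding comm_subgroup_def by (intro mono_generate) blast

lemma comm_subgroup_le_left: "A \<lhd> G \<Longrightarrow> B \<lhd> G \<Longrightarrow> comm_subgroup G A B \<subseteq> A"
  using normal_comm_left normal_subset comm_subgroup_le_iff by metis

lemma comm_subgroup_le_right: "A \<lhd> G \<Longrightarrow> B \<lhd> G \<Longrightarrow> comm_subgroup G A B \<subseteq> B"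
  using normal_comm_right normal_subset comm_subgroup_le_iff by metis

lemma comm_subgroup_le_commute:
  assumes "A \<lhd> G" "B \<lhd> G"
  shows "comm_subgroup G A B \<subseteq> comm_subgroup G B A"
proof -
  have n: "comm_subgroup G B A \<lhd> G"
    using assms comm_subgroup_normal by simp
  have "comm G a b \<in> comm_subgroup G B A" if ab: "a \<in> A" "b \<in> B" for a b
  proof -
    have "comm G a b = inv (comm G b a)"
      by (rule inv_comm[symmetric])
        (simp_all add: normal_subset[OF assms(1) ab(1)] normal_subset[OF assms(2) ab(2)])
    then show ?thesis
      using subgroup.m_inv_closed[OF normal_imp_subgroup[OF n] comm_in_comm_subgroup] ab by simp
  qed
  then show ?thesis unfolding comm_subgroup_le_iff[OF n] by simp
qed

lemma comm_subgroup_commute: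
  "A \<lhd> G \<Longrightarrow> B \<lhd> G \<Longrightarrow> comm_subgroup G A B = comm_subgroup G B A"
  using comm_subgroup_le_commute by (intro equalityI) auto

lemma le_resid_iff:
  assumes "A \<lhd> G" "P \<lhd> G"
  shows "A \<subseteq> resid G P B \<longleftrightarrow> comm_subgroup G A B \<subseteq> P"
  using normal_subset[OF assms(1)] by (auto simp: comm_subgroup_le_iff[OF assms(2)] resid_def)

text \<open>The Hall-Witt identity for \<open>a^-1\<close>, \<open>b\<close>, \<open>c\<close> has
  two factors in \<open>P\<close> by hypothesis, hence the third as well.\<close>

lemma three_subgroups:
  assumes n: "A \<lhd> G" "B \<lhd> G" "C \<lhd> G" "P \<lhd> G"
    and 1: "comm_subgroup G (comm_subgroup G A B) C \<subseteq> P"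
    and 2: "comm_subgroup G (comm_subgroup G B C) A \<subseteq> P"
  shows "comm_subgroup G (comm_subgroup G C A) B \<subseteq> P"
proof -
  interpret P: normal P G by fact
  interpret A: normal A G by fact
  interpret B: normal B G by fact
  interpret C: normal C G by fact
  have "comm G (comm G c a) b \<in> P" if "a \<in> A" "b \<in> B" "c \<in> C" for a b c
  proof -
    let ?u = "inv b \<otimes> comm G (comm G (inv a) (inv b)) c \<otimes> b"
    let ?v = "inv c \<otimes> comm G (comm G b (inv c)) (inv a) \<otimes> c"
    let ?w = "a \<otimes> comm G (comm G c a) b \<otimes> inv a"
    have car: "a \<in> carrier G" "b \<in> carrier G" "c \<in> carrier G"
      using that by auto
    have "comm G (comm G (inv a) (inv b)) c \<in> P" "comm G (comm G b (inv c)) (inv a) \<in> P"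
      using that subsetD[OF 1] subsetD[OF 2] by (simp_all add: comm_in_comm_subgroup)
    then have u: "?u \<in> P" and v: "?v \<in> P"
      using car P.inv_op_closed1 by blast+
    have "?u \<otimes> ?v \<otimes> ?w = \<one>"
      using hall_witt[of "inv a" b c] car by simp
    then have "inv ?w = ?u \<otimes> ?v"
      using car u v P.subset by (intro inv_equality) auto
    then have "inv ?w \<in> P" using u v by simp
    then have "?w \<in> P" using car P.m_inv_closed[of "inv ?w"] by simp
    then have "inv a \<otimes> ?w \<otimes> a \<in> P" using car P.inv_op_closed1 by blast
    then show ?thesis using car by (simp add: m_assoc)
  qed
  \<comment> \<open>So far only the generators \<open>[c, a]\<close> of \<open>[C, A]\<close> are
    covered; since \<open>resid G P B\<close> is a subgroup, it contains all of
    \<open>[C, A]\<close>.\<close>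
  then have "comm_subgroup G C A \<subseteq> resid G P B"
    unfolding comm_subgroup_le_iff[OF resid_normal[OF n(4,2)]] by (simp add: resid_def)
  then show ?thesis
    unfolding le_resid_iff[OF comm_subgroup_normal[OF n(3,1)] n(4)] .
qed

end

section \<open>Subgroups generated by commutators of a tuple\<close>

lemma (in group) gamma_closed:
  "\<forall>p. g p \<in> carrier G \<Longrightarrow> gamma G s g \<in> carrier G"
proof (induction s)
  case (Suc s)
  then show ?case by (cases s) auto
qed simp

lemma gamma_cong:
  "\<forall>p\<in>{1..s}. g p = g' p \<Longrightarrow> gamma G s g = gamma G s g'"
  by (induction G s g rule: gamma.induct) auto

text \<open>For normal entries and \<open>s \<ge> 1\<close> this is the subgroup
  \<open>\<gamma>\<^sub>s(M)\<close>: it contains the values by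
  \<open>gamma_in_gamma_subgroup\<close>, and by \<open>gamma_subgroup_leI\<close> every normal
  subgroup containing the values contains it. The value at 0 is a dummy.\<close>

fun gamma_subgroup :: "('a, 'b) monoid_scheme \<Rightarrow> (nat \<Rightarrow> 'a set) \<Rightarrow> nat \<Rightarrow> 'a set" where
  "gamma_subgroup G M 0 = {\<one>\<^bsub>G\<^esub>}"
| "gamma_subgroup G M (Suc 0) = M 1"
| "gamma_subgroup G M (Suc (Suc n)) = comm_subgroup G (gamma_subgroup G M (Suc n)) (M (Suc (Suc n)))"

lemma gamma_subgroup_Suc:
  "1 \<le> s \<Longrightarrow> gamma_subgroup G M (Suc s) = comm_subgroup G (gamma_subgroup G M s) (M (Suc s))"
  by (cases s) auto

lemma gamma_Suc:
  "1 \<le> s \<Longrightarrow> gamma G (Suc s) g = comm G (gamma G s g) (g (Suc s))"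
  by (cases s) auto

lemma gamma_subgroup_cong:
  "\<forall>p\<in>{1..s}. M p = M' p \<Longrightarrow> gamma_subgroup G M s = gamma_subgroup G M' s"
  by (induction G M s rule: gamma_subgroup.induct) auto

text \<open>For normal \<open>P\<close> and normal entries, the largest normal subgroup
  \<open>A\<close> such that \<open>[A, M (s+1), ..., M (s+d)]\<close> lies in
  \<open>P\<close>.\<close>

fun resid_chain :: "('a, 'b) monoid_scheme \<Rightarrow> (nat \<Rightarrow> 'a set) \<Rightarrow> 'a set \<Rightarrow> nat \<Rightarrow> nat \<Rightarrow> 'a set" where
  "resid_chain G M P s 0 = P"
| "resid_chain G M P s (Suc d) = resid G (resid_chain G M P (Suc s) d) (M (Suc s))"

text \<open>Two of the terms \<open>f 0, ..., f m\<close> agree, and their distance, being at most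
  \<open>m\<close>, divides \<open>m!\<close>. The factorial gives one exponent that works whichever
  terms agree.\<close>

lemma pigeonhole_dvd_fact:
  assumes "finite S" "card S \<le> m" "\<And>j. f j \<in> S"
  obtains j d :: nat where "0 < d" "d dvd fact m" "f j = f (j + d)"
proof -
  have "\<not> inj_on f {..m}"
  proof
    assume "inj_on f {..m}"
    then have "card {..m} \<le> card S"
      using assms by (intro card_inj_on_le[of f]) auto
    then show False using assms by simp
  qed
  then obtain a b where ab: "a \<le> m" "b \<le> m" "a < b" "f a = f b"
    unfolding inj_on_def by (metis atMost_iff linorder_neqE_nat)
  then have "f a = f (a + (b - a))" "b - a dvd fact m"
    by (auto intro!: dvd_fact)
  then show ?thesis using ab that[of "b - a" a] by simp
qed

context group
begin

lemma gamma_subgroup_normal: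
  assumes "\<And>p. M p \<lhd> G" shows "gamma_subgroup G M s \<lhd> G"
proof (induction s)
  case (Suc s)
  then show ?case using assms by (cases s) (simp_all add: comm_subgroup_normal)
qed (simp add: one_is_normal)

lemma gamma_in_gamma_subgroup:
  assumes "\<And>p. g p \<in> M p" shows "gamma G s g \<in> gamma_subgroup G M s"
proof (induction s)
  case (Suc s)
  then show ?case using assms by (cases s) (simp_all add: comm_in_comm_subgroup)
qed simp

lemma gamma_subgroup_mono:
  assumes "\<And>p. M p \<subseteq> M' p" shows "gamma_subgroup G M s \<subseteq> gamma_subgroup G M' s"
proof (induction s)
  case (Suc s)
  then show ?case using assms by (cases s) (simp_all add: comm_subgroup_mono)
qed simp

lemma gamma_subgroup_antimono:
  assumes n: "\<And>p. M p \<lhd> G" and "1 \<le> s" "s \<le> t"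
  shows "gamma_subgroup G M t \<subseteq> gamma_subgroup G M s"
  using \<open>s \<le> t\<close>
proof (induction t rule: dec_induct)
  case (step t)
  have "gamma_subgroup G M (Suc t) \<subseteq> gamma_subgroup G M t"
    using \<open>1 \<le> s\<close> step.hyps comm_subgroup_le_left[OF gamma_subgroup_normal[OF n] n]
    by (simp add: gamma_subgroup_Suc)
  then show ?case using step.IH by simp
qed simp

lemma gamma_subgroup_le:
  assumes n: "\<And>p. M p \<lhd> G" and "1 \<le> s" "s \<le> t"
  shows "gamma_subgroup G M t \<subseteq> M s"
proof -
  have "gamma_subgroup G M s \<subseteq> M s"
  proof (cases "s = 1")
    case False
    then obtain k where "s = Suc k" "1 \<le> k" using \<open>1 \<le> s\<close> by (cases s) auto
    then show ?thesis
      using comm_subgroup_le_right[OF gamma_subgroup_normal[OF n] n] by (simp add: gamma_subgroup_Suc)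
  qed simp
  then show ?thesis
    using gamma_subgroup_antimono[of M, OF n assms(2,3)] by simp
qed

text \<open>The commutator subgroups are formed with all elements of the previous subgroup, not just
  with values. Replacing \<open>P\<close> by \<open>resid G P (M (Suc s))\<close> in the induction
  reduces the claim to values.\<close>

lemma gamma_subgroup_leI:
  assumes n: "\<And>p. M p \<lhd> G" and "P \<lhd> G" "1 \<le> s"
    and "\<And>g. (\<And>p. g p \<in> M p) \<Longrightarrow> gamma G s g \<in> P"
  shows "gamma_subgroup G M s \<subseteq> P"
  using \<open>1 \<le> s\<close> assms(2,4)
proof (induction s arbitrary: P rule: dec_induct)
  case base
  show ?case
  proof
    fix x assume x: "x \<in> gamma_subgroup G M 1"
    have "\<one> \<in> M p" for p
      using n normal_imp_subgroup subgroup.one_closed by blast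
    then show "x \<in> P"
      using x base(2)[of "(\<lambda>_. \<one>)(1 := x)"] by simp
  qed
next
  case (step s)
  have "gamma G s g \<in> resid G P (M (Suc s))" if g: "\<And>p. g p \<in> M p" for g
  proof -
    have "comm G (gamma G s g) b \<in> P" if b: "b \<in> M (Suc s)" for b
    proof -
      \<comment> \<open>The value of length \<open>s\<close> ignores entry \<open>Suc s\<close>, so
        \<open>b\<close> can be put there.\<close>
      have "gamma G s (g(Suc s := b)) = gamma G s g"
        by (rule gamma_cong) auto
      moreover have "gamma G (Suc s) (g(Suc s := b)) \<in> P"
        using g b by (intro step.prems(2)) simp
      ultimately show ?thesis
        using step.hyps(1) by (simp add: gamma_Suc del: fun_upd_apply) simp
    qed
    moreover have "gamma G s g \<in> carrier G"
      using g normal_subset[OF n] by (intro gamma_closed) auto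
    ultimately show ?thesis by (simp add: resid_def)
  qed
  then have "gamma_subgroup G M s \<subseteq> resid G P (M (Suc s))"
    using step.IH resid_normal[OF step.prems(1) n] by blast
  then show ?case
    using step.hyps(1)
    by (simp add: gamma_subgroup_Suc le_resid_iff[OF gamma_subgroup_normal[OF n] step.prems(1)])
qed

text \<open>With \<open>K\<close> the subgroup of length \<open>s\<close> and \<open>B\<close> the
  next entry, the three subgroups lemma controls \<open>[[K, B], A]\<close> by
  \<open>[[B, A], K]\<close> and \<open>[[A, K], B]\<close>. The first is the hypothesis for the
  last position, the second the induction hypothesis with \<open>resid G P B\<close> in place of
  \<open>P\<close>.\<close>

lemma comm_gamma_subgroup_le:
  assumes n: "\<And>p. M p \<lhd> G" and A: "A \<lhd> G" and "P \<lhd> G" "1 \<le> s"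
    and "\<And>p. p \<in> {1..s} \<Longrightarrow> gamma_subgroup G (M(p := comm_subgroup G (M p) A)) s \<subseteq> P"
  shows "comm_subgroup G (gamma_subgroup G M s) A \<subseteq> P"
  using \<open>1 \<le> s\<close> assms(3,5)
proof (induction s arbitrary: P rule: dec_induct)
  case base
  then show ?case using base(2)[of 1] by simp
next
  case (step s)
  let ?K = "gamma_subgroup G M s" and ?B = "M (Suc s)"
  have nK: "?K \<lhd> G" using gamma_subgroup_normal[OF n] .
  have nM: "(M(p := comm_subgroup G (M p) A)) q \<lhd> G" for p q
    using n A comm_subgroup_normal by simp
  have "gamma_subgroup G (M(p := comm_subgroup G (M p) A)) s \<subseteq> resid G P ?B"
    if "p \<in> {1..s}" for p
    using step.prems(2)[of p] that step.hyps(1)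
    by (simp add: gamma_subgroup_Suc le_resid_iff[OF gamma_subgroup_normal[OF nM] step.prems(1)])
  then have "comm_subgroup G ?K A \<subseteq> resid G P ?B"
    using step.IH resid_normal[OF step.prems(1) n] by blast
  then have 1: "comm_subgroup G (comm_subgroup G A ?K) ?B \<subseteq> P"
    using le_resid_iff[OF comm_subgroup_normal[OF nK A] step.prems(1)]
    by (simp add: comm_subgroup_commute[OF A nK])
  have "gamma_subgroup G (M(Suc s := comm_subgroup G ?B A)) s = ?K"
    by (rule gamma_subgroup_cong) auto
  then have "comm_subgroup G ?K (comm_subgroup G ?B A) \<subseteq> P"
    using step.prems(2)[of "Suc s"] step.hyps(1)
    by (simp add: gamma_subgroup_Suc del: fun_upd_apply) simp
  then have 2: "comm_subgroup G (comm_subgroup G ?B A) ?K \<subseteq> P"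
    by (simp add: comm_subgroup_commute[OF nK comm_subgroup_normal[OF n A]])
  show ?case
    using three_subgroups[OF n A nK step.prems(1) 2 1] step.hyps(1)
    by (simp add: gamma_subgroup_Suc)
qed

lemma resid_chain_normal:
  assumes "\<And>p. M p \<lhd> G" "P \<lhd> G" shows "resid_chain G M P s d \<lhd> G"
  using assms by (induction d arbitrary: s) (auto intro: resid_normal)

text \<open>\<open>le_resid_iff\<close> is applied once for each position after \<open>s\<close>,
  where the two tuples agree.\<close>

lemma gamma_subgroup_le_resid_chain:
  assumes n: "\<And>p. M p \<lhd> G" "\<And>p. M' p \<lhd> G" "P \<lhd> G" and "1 \<le> s"
    and "\<And>p. p \<in> {s<..s+d} \<Longrightarrow> M' p = M p"
    and "gamma_subgroup G M' (s + d) \<subseteq> P"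
  shows "gamma_subgroup G M' s \<subseteq> resid_chain G M P s d"
  using assms(4-)
proof (induction d arbitrary: s)
  case (Suc d)
  have "gamma_subgroup G M' (Suc s) \<subseteq> resid_chain G M P (Suc s) d"
    using Suc.prems by (intro Suc.IH) auto
  moreover have "M' (Suc s) = M (Suc s)"
    using Suc.prems by simp
  ultimately show ?case
    using Suc.prems(1)
    by (simp add: gamma_subgroup_Suc
        le_resid_iff[OF gamma_subgroup_normal[OF n(2)] resid_chain_normal[OF n(1,3)]])
qed simp

section \<open>Powers of one entry of a commutator, modulo normal subgroups\<close>

lemma comm_mult_left_eq:
  assumes "x \<in> carrier G" "y \<in> carrier G" "z \<in> carrier G" "comm G x z = \<one>"
  shows "comm G (x \<otimes> y) z = comm G y z"
  using assms by (simp add: comm_mult_left)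

lemma comm_nat_pow_left:
  assumes "x \<in> carrier G" "y \<in> carrier G" "comm G (comm G x y) x = \<one>"
  shows "comm G (x [^] (n::nat)) y = comm G x y [^] n"
proof (induction n)
  case (Suc n)
  let ?c = "comm G x y"
  have "?c \<otimes> x = x \<otimes> ?c"
    using assms comm_eq_one_iff[of ?c x] by simp
  then have c: "?c [^] n \<otimes> x = x \<otimes> ?c [^] n"
    using assms by (simp add: group_commutes_pow)
  have "comm G (x [^] Suc n) y = inv x \<otimes> (?c [^] n \<otimes> x) \<otimes> ?c"
    using assms Suc by (simp add: comm_mult_left m_assoc)
  then show ?case using assms by (simp add: c)
qed (use assms in \<open>simp add: comm_def\<close>)

lemma comm_nat_pow_right:
  assumes "x \<in> carrier G" "y \<in> carrier G" "comm G (comm G x y) y = \<one>"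
  shows "comm G x (y [^] (n::nat)) = comm G x y [^] n"
proof (induction n)
  case (Suc n)
  let ?c = "comm G x y"
  have "?c \<otimes> y = y \<otimes> ?c"
    using assms comm_eq_one_iff[of ?c y] by simp
  then have c: "?c [^] n \<otimes> y = y \<otimes> ?c [^] n"
    using assms by (simp add: group_commutes_pow)
  have "comm G x (y [^] Suc n) = ?c \<otimes> (inv y \<otimes> (?c [^] n \<otimes> y))"
    using assms Suc by (simp add: comm_mult_right m_assoc)
  then have "comm G x (y [^] Suc n) = ?c \<otimes> ?c [^] n"
    using assms by (simp add: c)
  then show ?case using assms by (simp only: nat_pow_Suc2 comm_closed)
qed (use assms in \<open>simp add: comm_def\<close>)

text \<open>The inductive step towards linearity, with the modulus changing from \<open>R\<close> to
  \<open>P\<close>. Write \<open>a = q b^j\<close> with \<open>q\<close> in \<open>R\<close>: modulo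
  \<open>P\<close>, the factor \<open>q\<close> commutes with \<open>h\<close> and drops out, and
  \<open>[b, h]\<close> commutes with \<open>b\<close>, so the exponent comes out.\<close>

lemma comm_nat_pow_left_mod:
  assumes P: "P \<lhd> G" and R: "R \<lhd> G" "R \<subseteq> resid G P B"
    and car: "a \<in> carrier G" "b \<in> carrier G" "h \<in> carrier G" and h: "h \<in> B"
    and ab: "R #> a = R #> b [^] (j::nat)" and "comm G (comm G b h) b \<in> P"
  shows "P #> comm G a h = P #> comm G b h [^] j"
proof -
  interpret \<pi>: group_hom G "G Mod P" "(#>) P" using P by (rule group_hom_Mod)
  have "a \<in> R #> b [^] j"
    using rcos_self[OF car(1) normal_imp_subgroup[OF R(1)]] ab by simp
  then obtain q where q: "q \<in> R" "a = q \<otimes> b [^] j"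
    by (auto simp: r_coset_def)
  have qc: "q \<in> carrier G" "comm G q h \<in> P"
    using q R h by (auto simp: resid_def)
  have 1: "comm (G Mod P) (P #> q) (P #> h) = \<one>\<^bsub>G Mod P\<^esub>"
    using qc car Mod_eq_one_iff[OF P, of "comm G q h"] \<pi>.hom_comm by simp
  have 2: "comm (G Mod P) (comm (G Mod P) (P #> b) (P #> h)) (P #> b) = \<one>\<^bsub>G Mod P\<^esub>"
    using assms(9) car Mod_eq_one_iff[OF P, of "comm G (comm G b h) b"] \<pi>.hom_comm by simp
  have "P #> comm G a h = comm (G Mod P) ((P #> q) \<otimes>\<^bsub>G Mod P\<^esub> (P #> b) [^]\<^bsub>G Mod P\<^esub> j) (P #> h)"
    using q(2) qc car by (simp add: \<pi>.hom_comm \<pi>.hom_nat_pow)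
  also have "\<dots> = comm (G Mod P) ((P #> b) [^]\<^bsub>G Mod P\<^esub> j) (P #> h)"
    using qc car 1 by (intro \<pi>.H.comm_mult_left_eq) (auto simp del: one_FactGroup)
  also have "\<dots> = comm (G Mod P) (P #> b) (P #> h) [^]\<^bsub>G Mod P\<^esub> j"
    using car 2 by (intro \<pi>.H.comm_nat_pow_left) (auto simp del: one_FactGroup)
  also have "\<dots> = P #> comm G b h [^] j"
    using car by (simp add: \<pi>.hom_comm \<pi>.hom_nat_pow)
  finally show ?thesis .
qed

text \<open>Induction on the length from \<open>i\<close> to \<open>r\<close>, with a modulus
  \<open>R s\<close> for each length. \<open>base\<close> takes the exponent out of position
  \<open>i\<close>, \<open>step\<close> takes it out of the left entry of each later commutator, and
  \<open>chain\<close> carries the error from \<open>R s\<close> into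
  \<open>R (Suc s)\<close>.\<close>

lemma gamma_linear_mod:
  assumes n: "\<And>p. M p \<lhd> G" and R: "\<And>s. R s \<lhd> G" and "1 \<le> i"
    and chain: "\<And>s. s \<in> {i..<r} \<Longrightarrow> R s \<subseteq> resid G (R (Suc s)) (M (Suc s))"
    and base: "comm_subgroup G (gamma_subgroup G M i) (M i) \<subseteq> R i"
    and step: "\<And>s. s \<in> {i..<r} \<Longrightarrow>
      comm_subgroup G (gamma_subgroup G M (Suc s)) (gamma_subgroup G M s) \<subseteq> R (Suc s)"
    and g: "\<And>p. g p \<in> M p" and "i \<le> r"
  shows "R r #> gamma G r (g(i := g i [^] (j::nat))) = R r #> gamma G r g [^] j"
proof -
  let ?g = "g(i := g i [^] j)"
  have gc: "g p \<in> carrier G" for p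
    using g normal_subset[OF n] by blast
  have gc': "?g p \<in> carrier G" for p using gc by simp
  have "s \<le> r \<Longrightarrow> R s #> gamma G s ?g = R s #> gamma G s g [^] j" if "i \<le> s" for s
    using that
  proof (induction s rule: dec_induct)
    case base
    show ?case
    \<comment> \<open>For \<open>i = 1\<close> the value is the entry itself; otherwise entry
      \<open>i\<close> is the right argument of a commutator.\<close>
    proof (cases "i = 1")
      case False
      then obtain k where k: "i = Suc k" "1 \<le> k" using \<open>1 \<le> i\<close> by (cases i) auto
      let ?w = "gamma G k g"
      interpret \<pi>: group_hom G "G Mod R i" "(#>) (R i)" using R by (rule group_hom_Mod)
      have w: "?w \<in> carrier G" using gc by (intro gamma_closed) auto
      have "gamma G k ?g = ?w" using k by (intro gamma_cong) auto
      then have eq: "gamma G i ?g = comm G ?w (g i [^] j)" "gamma G i g = comm G ?w (g i)"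
        using k by (simp_all add: gamma_Suc)
      have "comm G ?w (g i) \<in> gamma_subgroup G M i"
        using gamma_in_gamma_subgroup[of g M i] g eq by simp
      then have "comm G (comm G ?w (g i)) (g i) \<in> R i"
        using assms(5) comm_in_comm_subgroup g by blast
      then have "comm (G Mod R i) (comm (G Mod R i) (R i #> ?w) (R i #> g i)) (R i #> g i) = \<one>\<^bsub>G Mod R i\<^esub>"
        using w gc Mod_eq_one_iff[OF R, of "comm G (comm G ?w (g i)) (g i)" i] \<pi>.hom_comm by simp
      then have "comm (G Mod R i) (R i #> ?w) ((R i #> g i) [^]\<^bsub>G Mod R i\<^esub> j) =
          comm (G Mod R i) (R i #> ?w) (R i #> g i) [^]\<^bsub>G Mod R i\<^esub> j"
        using w gc by (intro \<pi>.H.comm_nat_pow_right) auto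
      then show ?thesis
        unfolding eq using w gc by (simp add: \<pi>.hom_comm \<pi>.hom_nat_pow)
    qed simp
  next
    case (step s)
    then have "1 \<le> s" using \<open>1 \<le> i\<close> by simp
    have "?g (Suc s) = g (Suc s)" using step.hyps by simp
    then have eq: "gamma G (Suc s) ?g = comm G (gamma G s ?g) (g (Suc s))"
      "gamma G (Suc s) g = comm G (gamma G s g) (g (Suc s))"
      using \<open>1 \<le> s\<close> by (simp_all add: gamma_Suc)
    have "comm G (gamma G s g) (g (Suc s)) \<in> gamma_subgroup G M (Suc s)"
      using gamma_in_gamma_subgroup[of g M "Suc s"] g eq by simp
    moreover have "gamma G s g \<in> gamma_subgroup G M s"
      using gamma_in_gamma_subgroup g by blast
    ultimately have "comm G (comm G (gamma G s g) (g (Suc s))) (gamma G s g) \<in> R (Suc s)"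
      using assms(6)[of s] step.hyps step.prems comm_in_comm_subgroup by (auto elim!: subsetD)
    moreover have "R s \<subseteq> resid G (R (Suc s)) (M (Suc s))"
      using step.hyps step.prems by (intro chain) simp
    ultimately show ?case
      unfolding eq using step.hyps step.prems g gc R
      by (intro comm_nat_pow_left_mod[OF R R _ _ _ _ _ step.IH]) (simp_all add: gc' gamma_closed)
  qed
  then show ?thesis using \<open>i \<le> r\<close> by simp
qed

text \<open>Replacing \<open>g i\<close> by its powers gives values in \<open>X\<close> that are,
  modulo \<open>R r\<close>, the powers of \<open>gamma G r g\<close>. Two of these values agree,
  say for \<open>j\<close> and \<open>j + d\<close>, so the \<open>d\<close>-th power of
  \<open>gamma G r g\<close> lies in \<open>R r\<close>, and \<open>d\<close> divides
  \<open>m!\<close>.\<close>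

lemma gamma_pow_fact_mem:
  assumes n: "\<And>p. M p \<lhd> G" and R: "\<And>s. R s \<lhd> G" and "1 \<le> i"
    and "\<And>s. s \<in> {i..<r} \<Longrightarrow> R s \<subseteq> resid G (R (Suc s)) (M (Suc s))"
    and "comm_subgroup G (gamma_subgroup G M i) (M i) \<subseteq> R i"
    and "\<And>s. s \<in> {i..<r} \<Longrightarrow>
      comm_subgroup G (gamma_subgroup G M (Suc s)) (gamma_subgroup G M s) \<subseteq> R (Suc s)"
    and g: "\<And>p. g p \<in> M p" and "i \<le> r"
    and X: "finite X" "card X \<le> m" "\<And>g. (\<And>p. g p \<in> M p) \<Longrightarrow> gamma G r g \<in> X"
  shows "gamma G r g [^] (fact m :: nat) \<in> R r"
proof -
  interpret \<pi>: group_hom G "G Mod R r" "(#>) (R r)" using R by (rule group_hom_Mod)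
  interpret R: normal "R r" G by fact
  let ?f = "\<lambda>j::nat. gamma G r (g(i := g i [^] j))"
  let ?x = "gamma G r g"
  have x: "?x \<in> carrier G" using g normal_subset[OF n] by (intro gamma_closed) blast
  interpret Mi: normal "M i" G by (rule n)
  have "g i [^] (j::nat) \<in> M i" for j
    using g by (induction j) simp_all
  then have "?f j \<in> X" for j
    using X(3) g by simp
  then obtain j d :: nat where d: "0 < d" "d dvd fact m" "?f j = ?f (j + d)"
    using pigeonhole_dvd_fact[OF X(1,2), of ?f] by blast
  have f: "R r #> ?f k = R r #> ?x [^] k" for k
    by (rule gamma_linear_mod[OF assms(1-8)])
  have "R r #> ?x [^] j = R r #> ?x [^] (j + d)"
    using f[of j] f[of "j + d"] d(3) by simp
  also have "\<dots> = (R r #> ?x [^] j) \<otimes>\<^bsub>G Mod R r\<^esub> (R r #> ?x [^] d)"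
    using x by (simp flip: nat_pow_mult)
  finally have "R r #> ?x [^] d = \<one>\<^bsub>G Mod R r\<^esub>"
    using x \<pi>.H.l_cancel_one'[of "R r #> ?x [^] j" "R r #> ?x [^] d"] by simp
  then have "?x [^] d \<in> R r"
    using x Mod_eq_one_iff[OF R] by simp
  moreover obtain c where "(fact m :: nat) = d * c" using d(2) by (auto simp: dvd_def)
  moreover have "y [^] k \<in> R r" if "y \<in> R r" for y and k :: nat
    using that by (induction k) simp_all
  moreover have "?x [^] (d * c) = (?x [^] d) [^] c"
    using x by (simp add: nat_pow_pow)
  ultimately show ?thesis by simp
qed

end

section \<open>The case of commuting values\<close>

context group
begin

lemma generate_commute:
  assumes "X \<subseteq> carrier G" "y \<in> carrier G" "\<And>x. x \<in> X \<Longrightarrow> x \<otimes> y = y \<otimes> x"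
    and "u \<in> generate G X"
  shows "u \<otimes> y = y \<otimes> u"
proof -
  let ?C = "{u \<in> carrier G. u \<otimes> y = y \<otimes> u}"
  have "subgroup ?C G"
  proof (rule subgroupI)
    show "?C \<noteq> {}" using assms(2) by auto
    fix a assume a: "a \<in> ?C"
    then have ac: "a \<in> carrier G" by simp
    have "inv a \<otimes> y = inv a \<otimes> (y \<otimes> a) \<otimes> inv a"
      using ac assms(2) by (simp add: m_assoc)
    also have "\<dots> = inv a \<otimes> (a \<otimes> y) \<otimes> inv a"
      using a by simp
    also have "\<dots> = y \<otimes> inv a"
      using ac assms(2) by (simp add: m_assoc)
    finally show "inv a \<in> ?C" using a by simp
    fix b assume b: "b \<in> ?C"
    then have bc: "b \<in> carrier G" by simp
    have "a \<otimes> b \<otimes> y = a \<otimes> (y \<otimes> b)"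
      using b ac assms(2) by (simp add: m_assoc)
    also have "\<dots> = (a \<otimes> y) \<otimes> b"
      using ac bc assms(2) by (simp add: m_assoc)
    also have "\<dots> = (y \<otimes> a) \<otimes> b"
      using a by simp
    also have "\<dots> = y \<otimes> (a \<otimes> b)"
      using ac bc assms(2) by (simp add: m_assoc)
    finally show "a \<otimes> b \<in> ?C" using a b by simp
  qed auto
  moreover have "X \<subseteq> ?C" using assms(1,3) by auto
  ultimately have "generate G X \<subseteq> ?C" by (intro generate_subgroup_incl)
  then show ?thesis using assms(4) by auto
qed

text \<open>The moduli for \<open>gamma_pow_fact_mem\<close> are the residual chains ending in
  \<open>P\<close>. \<open>left\<close> supplies the condition at position \<open>i\<close> by way
  of \<open>comm_gamma_subgroup_le\<close>, and \<open>right\<close> supplies those at later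
  positions.\<close>

lemma gamma_pow_fact_mem_move:
  assumes n: "\<And>p. M p \<lhd> G" and P: "P \<lhd> G" and i: "1 < i" "i \<le> r"
    and left: "\<And>p. p \<in> {1..<i} \<Longrightarrow> gamma_subgroup G (M(p := comm_subgroup G (M p) (M i))) r \<subseteq> P"
    and right: "\<And>p. p \<in> {i<..r} \<Longrightarrow> gamma_subgroup G (M(p := gamma_subgroup G M p)) r \<subseteq> P"
    and X: "finite X" "card X \<le> m" "\<And>g. (\<And>p. g p \<in> M p) \<Longrightarrow> gamma G r g \<in> X"
    and g: "\<And>p. g p \<in> M p"
  shows "gamma G r g [^] (fact m :: nat) \<in> P"
proof -
  let ?R = "\<lambda>s. resid_chain G M P s (r - s)"
  note nG = gamma_subgroup_normal[of M, OF n]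
  have R: "?R s \<lhd> G" for s
    using resid_chain_normal[of M, OF n P] .
  have R_step: "?R s = resid G (?R (Suc s)) (M (Suc s))" if "s < r" for s
    using that by (simp add: Suc_diff_Suc[symmetric])
  obtain k where k: "i = Suc k" "1 \<le> k" using i by (cases i) auto
  have nM: "(M(p := A)) q \<lhd> G" if "A \<lhd> G" for p q A
    using n that by simp
  have "gamma_subgroup G (M(p := comm_subgroup G (M p) (M i))) k \<subseteq> ?R k" if "p \<in> {1..k}" for p
  proof (rule gamma_subgroup_le_resid_chain[OF n nM[OF comm_subgroup_normal[OF n n]] P k(2)])
    show "gamma_subgroup G (M(p := comm_subgroup G (M p) (M i))) (k + (r - k)) \<subseteq> P"
      using that k i left[of p] by (simp del: fun_upd_apply)
  qed (use that in auto)
  then have "comm_subgroup G (gamma_subgroup G M k) (M i) \<subseteq> ?R k"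
    using comm_gamma_subgroup_le[of M, OF n n R k(2)] by simp
  \<comment> \<open>Unfolding \<open>?R k\<close> once puts a second commutator with
    \<open>M i\<close> into \<open>?R i\<close>.\<close>
  then have "gamma_subgroup G M i \<subseteq> resid G (?R i) (M i)"
    using R_step[of k] k i by (simp add: gamma_subgroup_Suc)
  then have base: "comm_subgroup G (gamma_subgroup G M i) (M i) \<subseteq> ?R i"
    by (simp add: le_resid_iff[OF nG R])
  have step: "comm_subgroup G (gamma_subgroup G M (Suc s)) (gamma_subgroup G M s) \<subseteq> ?R (Suc s)"
    if "s \<in> {i..<r}" for s
  proof -
    \<comment> \<open>With this entry the subgroup of length \<open>Suc s\<close> becomes exactly
      the commutator subgroup to be bounded.\<close>
    let ?M = "M(Suc s := gamma_subgroup G M (Suc s))"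
    have "gamma_subgroup G ?M s = gamma_subgroup G M s"
      by (rule gamma_subgroup_cong) auto
    then have "gamma_subgroup G ?M (Suc s) = comm_subgroup G (gamma_subgroup G M s) (gamma_subgroup G M (Suc s))"
      using that i by (simp add: gamma_subgroup_Suc del: fun_upd_apply) simp
    moreover have "gamma_subgroup G ?M (Suc s) \<subseteq> ?R (Suc s)"
    proof (rule gamma_subgroup_le_resid_chain[OF n nM[OF nG] P])
      show "gamma_subgroup G ?M (Suc s + (r - Suc s)) \<subseteq> P"
        using that right[of "Suc s"] by (simp del: fun_upd_apply)
    qed auto
    ultimately show ?thesis
      using comm_subgroup_commute[OF nG nG] by simp
  qed
  have "gamma G r g [^] (fact m :: nat) \<in> ?R r"
    using i R_step
    by (intro gamma_pow_fact_mem[OF n R _ _ base step g _ X]) auto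
  then show ?thesis by simp
qed

end

text \<open>The situation after factoring out the commutators of the values. Values may coincide in
  the quotient, so the size of \<open>X\<close> is only bounded by \<open>m\<close>.\<close>

locale commuting_gamma_values = group G for G (structure) +
  fixes N :: "nat \<Rightarrow> 'a set" and r m :: nat and X :: "'a set"
  assumes normal_N: "N p \<lhd> G"
    and X: "finite X" "card X \<le> m" "(\<And>p. g p \<in> N p) \<Longrightarrow> gamma G r g \<in> X"
    and X_conj: "x \<in> X \<Longrightarrow> z \<in> carrier G \<Longrightarrow> z \<otimes> x \<otimes> inv z \<in> X"
    and X_carrier: "X \<subseteq> carrier G"
    and X_commute: "x \<in> X \<Longrightarrow> y \<in> X \<Longrightarrow> x \<otimes> y = y \<otimes> x"
    and r: "1 \<le> r"
begin

definition admissible :: "(nat \<Rightarrow> 'a set) \<Rightarrow> bool" where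
  "admissible M \<longleftrightarrow> (\<forall>p. M p \<lhd> G \<and> M p \<subseteq> N p)"

definition exponent_divides :: "nat \<Rightarrow> (nat \<Rightarrow> 'a set) \<Rightarrow> bool" where
  "exponent_divides e M \<longleftrightarrow> (\<forall>g. (\<forall>p. g p \<in> M p) \<longrightarrow> gamma G r g [^] e = \<one>)"

lemma generate_X_normal: "generate G X \<lhd> G"
  using X_carrier X_conj by (rule normal_generateI)

lemma generate_X_commute:
  assumes "x \<in> generate G X" "y \<in> generate G X"
  shows "x \<otimes> y = y \<otimes> x"
proof (rule generate_commute[OF X_carrier _ _ assms(1)])
  show "y \<in> carrier G"
    using assms(2) X_carrier generate_in_carrier by blast
  then show "u \<otimes> y = y \<otimes> u" if "u \<in> X" for u
    using generate_commute[OF X_carrier _ _ assms(2), of u] that X_carrier X_commute by auto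
qed

text \<open>The \<open>e\<close>-torsion of the abelian subgroup generated by \<open>X\<close>. It
  serves as the modulus \<open>P\<close> of \<open>gamma_pow_fact_mem_move\<close>.\<close>

definition exponent_subgroup :: "nat \<Rightarrow> 'a set" where
  "exponent_subgroup e = {x \<in> generate G X. x [^] e = \<one>}"

lemma exponent_subgroup_normal: "exponent_subgroup e \<lhd> G"
proof -
  interpret L: normal "generate G X" G by (rule generate_X_normal)
  show ?thesis
  proof (rule normal_invI)
    show "subgroup (exponent_subgroup e) G"
    proof (rule subgroupI)
      show "exponent_subgroup e \<subseteq> carrier G"
        by (auto simp: exponent_subgroup_def)
      have "\<one> \<in> exponent_subgroup e"
        by (simp add: exponent_subgroup_def)
      then show "exponent_subgroup e \<noteq> {}" by blast
    qed (auto simp: exponent_subgroup_def nat_pow_inv pow_mult_distrib generate_X_commute)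
    show "z \<otimes> x \<otimes> inv z \<in> exponent_subgroup e" if "z \<in> carrier G" "x \<in> exponent_subgroup e" for x z
    proof -
      have "(z \<otimes> x \<otimes> inv z) [^] k = z \<otimes> x [^] k \<otimes> inv z" for k :: nat
        using that by (induction k) (simp_all add: exponent_subgroup_def m_assoc)
      then show ?thesis
        using that by (simp add: exponent_subgroup_def L.inv_op_closed2)
    qed
  qed
qed

lemma gamma_in_generate_X:
  assumes "admissible M" "\<And>p. g p \<in> M p" shows "gamma G r g \<in> generate G X" 
proof (intro generate.incl X(3))
  show "g p \<in> N p" for p using assms by (auto simp: admissible_def)
qed

lemma admissible_normal: "admissible M \<Longrightarrow> M p \<lhd> G"
  by (simp add: admissible_def)

lemma admissible_N: "admissible N"
  by (simp add: admissible_def normal_N)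

lemma admissible_upd:
  "admissible M \<Longrightarrow> A \<lhd> G \<Longrightarrow> A \<subseteq> M p \<Longrightarrow> admissible (M(p := A))"
  by (auto simp: admissible_def)

text \<open>The exponent is known for values only; it extends to the subgroup because the
  \<open>e\<close>-torsion is a normal subgroup.\<close>

lemma exponent_divides_imp_le:
  assumes M: "admissible M" and "exponent_divides e M"
  shows "gamma_subgroup G M r \<subseteq> exponent_subgroup e"
  using assms gamma_in_generate_X[OF M] admissible_normal[OF M] r
  by (intro gamma_subgroup_leI exponent_subgroup_normal)
    (auto simp: exponent_subgroup_def exponent_divides_def)

lemma exponent_divides_dvd:
  assumes M: "admissible M" and "exponent_divides e M" "e dvd e'"
  shows "exponent_divides e' M"
proof -
  obtain c where c: "e' = e * c" using assms by (auto simp: dvd_def)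
  have "gamma G r g [^] e' = \<one>" if g: "\<And>p. g p \<in> M p" for g
  proof -
    have "gamma G r g \<in> carrier G"
      using g normal_subset[OF admissible_normal[OF M]] by (intro gamma_closed) blast
    then have "gamma G r g [^] e' = (gamma G r g [^] e) [^] c"
      by (simp add: c nat_pow_pow)
    then show ?thesis using assms(2) g by (simp add: exponent_divides_def)
  qed
  then show ?thesis by (simp add: exponent_divides_def)
qed

lemma exponent_divides_move:
  assumes M: "admissible M" and i: "1 < i" "i \<le> r"
    and left: "\<And>p. p \<in> {1..<i} \<Longrightarrow> exponent_divides e (M(p := comm_subgroup G (M p) (M i)))"
    and right: "\<And>p. p \<in> {i<..r} \<Longrightarrow> exponent_divides e (M(p := gamma_subgroup G M p))"
  shows "exponent_divides (fact m * e) M"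
proof -
  note n = admissible_normal[OF M]
  have "gamma G r g [^] (fact m * e) = \<one>" if g: "\<And>p. g p \<in> M p" for g
  proof -
    have "gamma G r g [^] (fact m :: nat) \<in> exponent_subgroup e"
    proof (rule gamma_pow_fact_mem_move[OF n exponent_subgroup_normal i _ _ X(1,2) _ g])
      show "gamma_subgroup G (M(p := comm_subgroup G (M p) (M i))) r \<subseteq> exponent_subgroup e"
        if "p \<in> {1..<i}" for p
        using M left[OF that] comm_subgroup_normal[OF n n] comm_subgroup_le_left[OF n n]
        by (intro exponent_divides_imp_le admissible_upd)
      show "gamma_subgroup G (M(p := gamma_subgroup G M p)) r \<subseteq> exponent_subgroup e"
        if "p \<in> {i<..r}" for p
        using M right[OF that] gamma_subgroup_normal[of M, OF n] gamma_subgroup_le[of M, OF n, of p p] that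
        by (intro exponent_divides_imp_le admissible_upd) auto
      show "gamma G r g \<in> X" if "\<And>p. g p \<in> M p" for g
        using that M by (intro X(3)) (auto simp: admissible_def)
    qed
    moreover have "gamma G r g \<in> carrier G"
      using g normal_subset[OF n] by (intro gamma_closed) blast
    ultimately show ?thesis
      by (simp add: exponent_subgroup_def nat_pow_pow)
  qed
  then show ?thesis by (simp add: exponent_divides_def)
qed

text \<open>This ends the recursion. \<open>M i\<close> lies in the abelian subgroup generated by
  \<open>X\<close>, and the commutators that \<open>gamma_pow_fact_mem\<close> asks about are
  between subgroups of \<open>M i\<close>. They vanish, so all moduli can be trivial.\<close>

lemma exponent_divides_fact:
  assumes M: "admissible M" and i: "1 \<le> i" "i \<le> r" and Mi: "M i \<subseteq> gamma_subgroup G N r"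
  shows "exponent_divides (fact m) M"
proof -
  note n = admissible_normal[OF M]
  have "gamma_subgroup G N r \<subseteq> generate G X"
    using normal_N generate_X_normal r X(3)
    by (intro gamma_subgroup_leI) (auto intro: generate.incl)
  then have L: "M i \<subseteq> generate G X" using Mi by blast
  have comm: "comm_subgroup G A B \<subseteq> {\<one>}" if "A \<subseteq> M i" "B \<subseteq> M i" for A B
  proof -
    have "comm G a b = \<one>" if "a \<in> M i" "b \<in> M i" for a b
      using that L generate_X_commute[of a b] normal_subset[OF n]
      by (subst comm_eq_one_iff) auto
    then show ?thesis
      using that comm_subgroup_le_iff[OF one_is_normal] by auto
  qed
  have "gamma G r g [^] (fact m :: nat) \<in> {\<one>}" if g: "\<And>p. g p \<in> M p" for g
  proof (rule gamma_pow_fact_mem[of M "\<lambda>_. {\<one>}" i, OF n one_is_normal i(1) _ _ _ g i(2) X(1,2)])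
    show "{\<one>} \<subseteq> resid G {\<one>} (M (Suc s))" for s
      using normal_subset[OF n] by (auto simp: resid_def comm_def)
    show "comm_subgroup G (gamma_subgroup G M i) (M i) \<subseteq> {\<one>}"
      using i gamma_subgroup_le[of M, OF n] by (intro comm) auto
    show "comm_subgroup G (gamma_subgroup G M (Suc s)) (gamma_subgroup G M s) \<subseteq> {\<one>}"
      if "s \<in> {i..<r}" for s
      using i that gamma_subgroup_le[of M, OF n] by (intro comm) auto
    show "gamma G r g \<in> X" if "\<And>p. g p \<in> M p" for g
      using that M by (intro X(3)) (auto simp: admissible_def)
  qed
  then show ?thesis by (simp add: exponent_divides_def)
qed

text \<open>
  The moves with \<open>i = max q t\<close> either replace one of the positions \<open>q\<close>, \<open>t\<close> by a smaller one or
  produce an entry inside \<open>[\<gamma>\<^sub>k(N), N\<^sub>k\<^sub>+\<^sub>1]\<close>, that is, inside the next term of the series.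
\<close>

lemma exponent_divides_pair:
  assumes k: "1 \<le> k" "k < r"
    and later: "\<And>M p q. admissible M \<Longrightarrow> p \<in> {k<..r} \<Longrightarrow> q \<in> {1..p} \<Longrightarrow>
      M q \<subseteq> gamma_subgroup G N p \<Longrightarrow> exponent_divides e M"
    and "admissible M" "q \<in> {1..k + 1}" "t \<in> {1..k + 1}" "q \<noteq> t"
    and "M q \<subseteq> gamma_subgroup G N k" "M t \<subseteq> N (k + 1)"
  shows "exponent_divides (fact m ^ (q + t) * e) M"
  using assms(4-)
proof (induction "q + t" arbitrary: q t M rule: less_induct)
  case less
  note M = \<open>admissible M\<close>
  note n = admissible_normal[OF M]
  \<comment> \<open>Moving at the larger position puts the smaller one, \<open>l\<close>, to its
    left, where the entry becomes \<open>[M l, M i]\<close>.\<close>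
  define i where "i = max q t"
  define l where "l = min q t"
  have il: "1 \<le> l" "l < i" "i \<le> k + 1" "{q, t} = {l, i}" "1 < i" "i \<le> r" "1 \<le> i"
    using less.prems k by (auto simp: i_def l_def)
  define e' where "e' = fact m ^ (q + t - 1) * e"
  have dvd: "fact m ^ s * e dvd e'" if "s < q + t" for s
    unfolding e'_def using that by (intro mult_dvd_mono le_imp_power_dvd) auto
  have eK: "comm_subgroup G (gamma_subgroup G N k) (N (k + 1)) = gamma_subgroup G N (k + 1)"
    using k by (simp add: gamma_subgroup_Suc)
  have qt: "comm_subgroup G (M q) (M t) \<subseteq> gamma_subgroup G N (k + 1)"
    unfolding eK[symmetric] using less.prems by (intro comm_subgroup_mono)
  then have li: "comm_subgroup G (M l) (M i) \<subseteq> gamma_subgroup G N (k + 1)"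
    using comm_subgroup_commute[OF n n, of q t] by (auto simp: i_def l_def max_def min_def)
  have "exponent_divides (fact m * e') M"
  proof (rule exponent_divides_move[OF M il(5,6)])
    fix p assume p: "p \<in> {1..<i}"
    let ?M = "M(p := comm_subgroup G (M p) (M i))"
    have M': "admissible ?M"
      using M comm_subgroup_normal[OF n n] comm_subgroup_le_left[OF n n] by (rule admissible_upd)
    have right: "comm_subgroup G (M p) (M i) \<subseteq> M i"
      using comm_subgroup_le_right[OF n n] .
    \<comment> \<open>Position \<open>l\<close> receives a subgroup of the next term of the series.
      Any other \<open>p < i\<close> receives a subgroup of \<open>M i\<close> and takes over the
      role of \<open>i\<close>, which decreases \<open>q + t\<close>.\<close>
    consider "p = l" | "p \<noteq> q" "p \<noteq> t" "i = q" | "p \<noteq> q" "p \<noteq> t" "i = t"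
      using p by (cases "q \<le> t") (auto simp: i_def l_def)
    then show "exponent_divides e' ?M"
    proof cases
      case 1
      then have "exponent_divides e ?M"
        using M' k il li by (intro later[of _ "k + 1" l]) auto
      then show ?thesis
        using exponent_divides_dvd[OF M' _] by (simp add: e'_def)
    next
      case 2
      then have "exponent_divides (fact m ^ (p + t) * e) ?M"
        using p less.prems right M' il by (intro less.hyps) auto
      then show ?thesis
        using exponent_divides_dvd[OF M' _ dvd] p 2 by simp
    next
      case 3
      then have "exponent_divides (fact m ^ (q + p) * e) ?M"
        using p less.prems right M' il by (intro less.hyps) auto
      then show ?thesis
        using exponent_divides_dvd[OF M' _ dvd] p 3 by simp
    qed
  next
    fix p assume p: "p \<in> {i<..r}"
    let ?M = "M(p := gamma_subgroup G M p)"
    have M': "admissible ?M"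
      using M gamma_subgroup_normal[of M, OF n] gamma_subgroup_le[of M, OF n, of p p] p
      by (intro admissible_upd) auto
    have "exponent_divides e ?M"
    \<comment> \<open>Up to position \<open>k + 1\<close> the new entry lies in
      \<open>[M l, M i]\<close>, because \<open>l < i < p\<close>; beyond it, the new entry lies in
      the term of the series with index \<open>p\<close>.\<close>
    proof (cases "p \<le> k + 1")
      case True
      obtain j where j: "i = Suc j" "1 \<le> j" "l \<le> j" using il by (cases i) auto
      have "gamma_subgroup G M p \<subseteq> gamma_subgroup G M i"
        using p il by (intro gamma_subgroup_antimono n) auto
      also have "\<dots> = comm_subgroup G (gamma_subgroup G M j) (M i)"
        using j by (simp add: gamma_subgroup_Suc)
      also have "\<dots> \<subseteq> comm_subgroup G (M l) (M i)"
        using il j by (intro comm_subgroup_mono gamma_subgroup_le n) auto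
      finally show ?thesis
        using li M' k p True il by (intro later[of _ "k + 1" p]) auto
    next
      case False
      have "gamma_subgroup G M p \<subseteq> gamma_subgroup G N p"
        using M by (intro gamma_subgroup_mono) (simp add: admissible_def)
      then show ?thesis
        using M' False p by (intro later[of _ p p]) auto
    qed
    then show "exponent_divides e' ?M"
      using exponent_divides_dvd[OF M' _] by (simp add: e'_def)
  qed
  moreover have "fact m * e' = fact m ^ (q + t) * e"
    using il less.prems by (cases "q + t") (auto simp: e'_def)
  ultimately show ?case by simp
qed

text \<open>Downward induction on \<open>k\<close> from \<open>k = r\<close>. The step pairs
  position \<open>q\<close> with \<open>t = k + 1\<close> and costs \<open>q + k + 1\<close> factors
  \<open>m!\<close>, at most \<open>2 * r\<close> of them since
  \<open>q \<le> k < r\<close>.\<close>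

lemma exponent_divides_of_le:
  assumes "admissible M" "1 \<le> k" "k \<le> r" "q \<in> {1..k}" "M q \<subseteq> gamma_subgroup G N k"
  shows "exponent_divides (fact m ^ (2 * r * (r - k) + 1)) M"
  using assms
proof (induction "r - k" arbitrary: k q M rule: less_induct)
  case less
  show ?case
  proof (cases "k = r")
    case True
    then show ?thesis
      using exponent_divides_fact[of M q] less.prems by simp
  next
    case False
    let ?e = "fact m ^ (2 * r * (r - (k + 1)) + 1)"
    have later: "exponent_divides ?e M'"
      if "admissible M'" "p \<in> {k<..r}" "q' \<in> {1..p}" "M' q' \<subseteq> gamma_subgroup G N p" for M' p q'
    proof -
      have "exponent_divides (fact m ^ (2 * r * (r - p) + 1)) M'"
        using that by (intro less.hyps[of _ _ q']) auto
      then show ?thesis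
        using that by (rule_tac exponent_divides_dvd) (auto intro!: le_imp_power_dvd)
    qed
    have "exponent_divides (fact m ^ (q + (k + 1)) * ?e) M"
      using less.prems False later by (intro exponent_divides_pair[of k]) (auto simp: admissible_def)
    moreover have "r - k = Suc (r - (k + 1))"
      using False less.prems by simp
    then have "q + (k + 1) + (2 * r * (r - (k + 1)) + 1) \<le> 2 * r * (r - k) + 1"
      using less.prems False by simp
    then have "(fact m :: nat) ^ (q + (k + 1)) * ?e dvd fact m ^ (2 * r * (r - k) + 1)"
      unfolding power_add[symmetric] by (rule le_imp_power_dvd)
    ultimately show ?thesis
      using less.prems(1) exponent_divides_dvd by blast
  qed
qed

text \<open>The case \<open>k = q = 1\<close> for the full tuple, whose first entry is
  \<open>\<gamma>\<^sub>1(N)\<close>.\<close>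

lemma gamma_pow_eq_one:
  assumes "\<And>p. g p \<in> N p"
  shows "gamma G r g [^] (fact m ^ (2 * r * (r - 1) + 1) :: nat) = \<one>"
  using exponent_divides_of_le[OF admissible_N, of 1 1] r assms
  by (simp add: exponent_divides_def)

end

section \<open>Dietzmann's lemma and the general case\<close>

definition list_prod :: "('a, 'b) monoid_scheme \<Rightarrow> 'a list \<Rightarrow> 'a" where
  "list_prod G xs = foldr (\<otimes>\<^bsub>G\<^esub>) xs \<one>\<^bsub>G\<^esub>"

lemma list_prod_simps [simp]:
  "list_prod G [] = \<one>\<^bsub>G\<^esub>"
  "list_prod G (x # xs) = x \<otimes>\<^bsub>G\<^esub> list_prod G xs"
  by (simp_all add: list_prod_def)

text \<open>Counts the words of length at most \<open>l\<close> over \<open>n\<close>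
  letters.\<close>

definition num_lists :: "nat \<Rightarrow> nat \<Rightarrow> nat" where
  "num_lists n l = (\<Sum>i\<le>l. n ^ i)"

lemma lists_image_bound:
  assumes "finite C" "card C \<le> n"
  shows "finite (f ` {xs. set xs \<subseteq> C \<and> length xs \<le> l})"
    and "card (f ` {xs. set xs \<subseteq> C \<and> length xs \<le> l}) \<le> num_lists n l"
proof -
  let ?S = "{xs. set xs \<subseteq> C \<and> length xs \<le> l}"
  have fin: "finite ?S" using assms by (intro finite_lists_length_le)
  then show "finite (f ` ?S)" by simp
  have "card (f ` ?S) \<le> card ?S" using fin by (rule card_image_le)
  also have "\<dots> = (\<Sum>i\<le>l. card C ^ i)" using assms by (intro card_lists_length_le)
  also have "\<dots> \<le> num_lists n l"
    unfolding num_lists_def using assms by (intro sum_mono power_mono) auto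
  finally show "card (f ` ?S) \<le> num_lists n l" .
qed

context group
begin

lemma list_prod_closed [simp]: "set xs \<subseteq> carrier G \<Longrightarrow> list_prod G xs \<in> carrier G"
  by (induction xs) auto

lemma list_prod_append:
  "set xs \<subseteq> carrier G \<Longrightarrow> set ys \<subseteq> carrier G \<Longrightarrow>
    list_prod G (xs @ ys) = list_prod G xs \<otimes> list_prod G ys"
  by (induction xs) (auto simp: m_assoc)

lemma list_prod_replicate:
  "x \<in> carrier G \<Longrightarrow> list_prod G (replicate n x) = x [^] n"
  by (induction n) (simp_all only: replicate_0 replicate_Suc list_prod_simps nat_pow_0 nat_pow_Suc2)

lemma conj_nat_pow:
  assumes "x \<in> carrier G" "y \<in> carrier G"
  shows "(inv y \<otimes> x \<otimes> y) [^] (n::nat) = inv y \<otimes> x [^] n \<otimes> y"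
  using assms by (induction n) (simp_all add: m_assoc)

text \<open>All occurrences of \<open>y\<close> are moved to the front, which conjugates the letters
  they pass by powers of \<open>y\<close>; these stay in \<open>C\<close>, and their number is
  unchanged.\<close>

lemma list_prod_collect:
  assumes C: "C \<subseteq> carrier G" "\<And>x y. x \<in> C \<Longrightarrow> y \<in> C \<Longrightarrow> inv y \<otimes> x \<otimes> y \<in> C"
    and y: "y \<in> C" and "set xs \<subseteq> C"
  shows "\<exists>ys. set ys \<subseteq> C \<and> length ys + count_list xs y = length xs \<and>
    list_prod G xs = y [^] count_list xs y \<otimes> list_prod G ys"
  using \<open>set xs \<subseteq> C\<close>
proof (induction xs)
  case (Cons x xs)
  let ?c = "count_list xs y"
  obtain ys where ys: "set ys \<subseteq> C" "length ys + ?c = length xs"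
    "list_prod G xs = y [^] ?c \<otimes> list_prod G ys"
    using Cons by auto
  have car: "x \<in> carrier G" "y \<in> carrier G" "list_prod G ys \<in> carrier G"
    using Cons.prems C(1) y ys(1) by auto
  show ?case
  proof (cases "x = y")
    case True
    have "list_prod G (x # xs) = y [^] Suc ?c \<otimes> list_prod G ys"
      using car by (simp only: True list_prod_simps ys(3) nat_pow_Suc2) (simp add: m_assoc)
    then show ?thesis using True ys(1,2) by (intro exI[of _ ys]) auto
  next
    case False
    let ?x = "inv (y [^] ?c) \<otimes> x \<otimes> y [^] ?c"
    have "inv (y [^] n) \<otimes> x \<otimes> y [^] n \<in> C" for n :: nat
    proof (induction n)
      case (Suc n)
      have "inv (y [^] Suc n) \<otimes> x \<otimes> y [^] Suc n = inv y \<otimes> (inv (y [^] n) \<otimes> x \<otimes> y [^] n) \<otimes> y"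
        using car by (simp add: inv_mult_group m_assoc)
      then show ?case using C(2)[OF Suc y] by simp
    qed (use Cons.prems car in simp)
    moreover have "list_prod G (x # xs) = y [^] ?c \<otimes> list_prod G (?x # ys)"
      using car by (simp add: ys(3) m_assoc)
    ultimately show ?thesis
      using False ys(1,2) by (intro exI[of _ "?x # ys"]) auto
  qed
qed simp

text \<open>A word longer than \<open>k * card C\<close> has a letter occurring at least
  \<open>k\<close> times; collecting it splits off a factor \<open>z\<close> on the left. The
  equation for the lengths records how often this happened, which \<open>comm_conj_class_pow\<close>
  exploits.\<close>

lemma list_prod_shorten:
  assumes C: "finite C" "C \<subseteq> carrier G" "\<And>x y. x \<in> C \<Longrightarrow> y \<in> C \<Longrightarrow> inv y \<otimes> x \<otimes> y \<in> C"
    and k: "0 < k" and z: "z \<in> carrier G" "\<And>x. x \<in> C \<Longrightarrow> x [^] (k::nat) = z" and "set xs \<subseteq> C"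
  shows "\<exists>ys q. set ys \<subseteq> C \<and> length ys \<le> k * card C \<and> length xs = length ys + k * q \<and>
    list_prod G xs = z [^] q \<otimes> list_prod G ys"
  using \<open>set xs \<subseteq> C\<close>
proof (induction xs rule: length_induct)
  case (1 xs)
  show ?case
  proof (cases "length xs \<le> k * card C")
    case True
    then show ?thesis using 1(2) C(2) by (intro exI[of _ xs] exI[of _ 0]) auto
  next
    case False
    have "\<exists>y\<in>C. k \<le> count_list xs y"
    proof (rule ccontr)
      assume "\<not> ?thesis"
      then have "\<And>y. y \<in> C \<Longrightarrow> count_list xs y \<le> k" by force
      then have "(\<Sum>y\<in>C. count_list xs y) \<le> card C * k"
        using sum_bounded_above[of C "count_list xs" k] by simp
      then show False
        using False sum_count_set[OF 1(2) C(1)] by (simp add: mult.commute)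
    qed
    then obtain y where y: "y \<in> C" "k \<le> count_list xs y" by blast
    let ?c = "count_list xs y"
    obtain ys where ys: "set ys \<subseteq> C" "length ys + ?c = length xs"
      "list_prod G xs = y [^] ?c \<otimes> list_prod G ys"
      using list_prod_collect[OF C(2,3) y(1) 1(2)] by blast
    let ?zs = "replicate (?c - k) y @ ys"
    have car: "y \<in> carrier G" "set ys \<subseteq> carrier G" using y C(2) ys(1) by auto
    have "?c = k + (?c - k)" using y by simp
    then have "y [^] ?c = z \<otimes> y [^] (?c - k)"
      using car y(1) z by (metis nat_pow_mult)
    moreover have "set (replicate (?c - k) y) \<subseteq> carrier G"
      using car by auto
    ultimately have xs: "list_prod G xs = z \<otimes> list_prod G ?zs"
      using car z by (simp add: ys(3) list_prod_append list_prod_replicate m_assoc)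
    have "length ?zs < length xs" "length xs = length ?zs + k" "set ?zs \<subseteq> C"
      using ys y k by auto
    then obtain ws q where ws: "set ws \<subseteq> C" "length ws \<le> k * card C"
      "length ?zs = length ws + k * q" "list_prod G ?zs = z [^] q \<otimes> list_prod G ws"
      using 1(1) by blast
    have "list_prod G ws \<in> carrier G" using ws(1) C(2) by auto
    then have "list_prod G xs = z [^] Suc q \<otimes> list_prod G ws"
      using z(1) by (simp only: xs ws(4) nat_pow_Suc2) (simp add: m_assoc)
    then show ?thesis
      using ws \<open>length xs = length ?zs + k\<close> by (intro exI[of _ ws] exI[of _ "Suc q"]) auto
  qed
qed

text \<open>Inverses are powers, so every element is a product over \<open>C\<close>;
  \<open>list_prod_shorten\<close> with \<open>z = \<one>\<close> bounds the number of
  factors.\<close>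

lemma dietzmann:
  assumes C: "finite C" "card C \<le> n" "C \<subseteq> carrier G"
      "\<And>x y. x \<in> C \<Longrightarrow> y \<in> C \<Longrightarrow> inv y \<otimes> x \<otimes> y \<in> C"
    and k: "0 < k" "\<And>x. x \<in> C \<Longrightarrow> x [^] (k::nat) = \<one>"
  shows "finite (generate G C)" and "card (generate G C) \<le> num_lists n (k * n)"
proof -
  let ?S = "list_prod G ` {xs. set xs \<subseteq> C \<and> length xs \<le> k * n}"
  have "\<exists>xs. set xs \<subseteq> C \<and> list_prod G xs = x" if "x \<in> generate G C" for x
    using that
  proof (induction rule: generate.induct)
    case one
    show ?case by (rule exI[of _ "[]"]) simp
  next
    case (incl h)
    then show ?case using C(3) by (intro exI[of _ "[h]"]) auto
  next
    case (inv h)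
    then have h: "h \<in> carrier G" using C(3) by blast
    have "h [^] (k - 1) \<otimes> h = \<one>"
      using k inv by (metis Suc_diff_1 nat_pow_Suc)
    then have "inv h = h [^] (k - 1)"
      using h by (intro inv_equality) auto
    then show ?case
      using h inv by (intro exI[of _ "replicate (k - 1) h"]) (auto simp: list_prod_replicate)
  next
    case (eng a b)
    then obtain xs ys where "set xs \<subseteq> C" "list_prod G xs = a" "set ys \<subseteq> C" "list_prod G ys = b"
      by blast
    then show ?case
      using C(3) by (intro exI[of _ "xs @ ys"]) (auto simp: list_prod_append)
  qed
  moreover have "list_prod G xs \<in> ?S" if xs: "set xs \<subseteq> C" for xs
  proof -
    obtain ys q where ys: "set ys \<subseteq> C" "length ys \<le> k * card C"
      "list_prod G xs = \<one> [^] (q::nat) \<otimes> list_prod G ys"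
      using list_prod_shorten[OF C(1,3,4) k(1) one_closed k(2) xs] by blast
    have "length ys \<le> k * n"
      using ys(2) mult_le_mono2[OF C(2), of k] by (rule le_trans)
    moreover have "list_prod G ys \<in> carrier G" using ys(1) C(3) by auto
    then have "list_prod G xs = list_prod G ys"
      using ys(3) by simp
    ultimately show ?thesis using ys(1) by blast
  qed
  ultimately have sub: "generate G C \<subseteq> ?S" by blast
  note S = lists_image_bound[OF C(1,2), of "list_prod G" "k * n"]
  show "finite (generate G C)" using sub S(1) by (rule finite_subset)
  show "card (generate G C) \<le> num_lists n (k * n)"
    using card_mono[OF S(1) sub] S(2) by simp
qed

lemma nat_pow_dvd_eq_one:
  assumes "x \<in> carrier G" "x [^] (d::nat) = \<one>" "d dvd e"
  shows "x [^] e = \<one>"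
  using assms by (metis dvdE nat_pow_one nat_pow_pow)

lemma nat_pow_fact_eq_one:
  assumes x: "x \<in> carrier G" and S: "finite S" "card S \<le> b" "\<And>j::nat. x [^] j \<in> S"
  shows "x [^] (fact b :: nat) = \<one>"
proof -
  obtain j d :: nat where d: "d dvd fact b" "x [^] j = x [^] (j + d)"
    using pigeonhole_dvd_fact[OF S(1,2), of "\<lambda>j. x [^] j"] S(3) by blast
  have "x [^] j \<otimes> x [^] d = x [^] (j + d)"
    using x by (rule nat_pow_mult)
  then have "x [^] j = x [^] j \<otimes> x [^] d"
    using d(2) by simp
  then have "x [^] d = \<one>"
    using x l_cancel_one'[of "x [^] j" "x [^] d"] by simp
  then show ?thesis using x d(1) nat_pow_dvd_eq_one by blast
qed

section \<open>Commutators within a finite set closed under conjugation\<close>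

context
  fixes X :: "'a set" and m :: nat
  assumes X: "finite X" "card X \<le> m" "X \<subseteq> carrier G"
    and X_conj: "\<And>x z. x \<in> X \<Longrightarrow> z \<in> carrier G \<Longrightarrow> z \<otimes> x \<otimes> inv z \<in> X"
begin

text \<open>The conjugates of \<open>u\<close> by powers of \<open>x\<close> stay in
  \<open>X\<close>, so two of them agree and some \<open>x^d\<close> with \<open>d\<close> dividing
  \<open>m!\<close> commutes with \<open>u\<close>.\<close>

lemma conj_class_pow_fact_commute:
  assumes "x \<in> X" "u \<in> X"
  shows "x [^] (fact m :: nat) \<otimes> u = u \<otimes> x [^] (fact m :: nat)"
proof -
  have car: "x \<in> carrier G" "u \<in> carrier G" using assms X by auto
  let ?f = "\<lambda>j::nat. x [^] j \<otimes> u \<otimes> inv (x [^] j)"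
  have "?f j \<in> X" for j using X_conj assms car by simp
  then obtain j d :: nat where d: "0 < d" "d dvd fact m" "?f j = ?f (j + d)"
    using pigeonhole_dvd_fact[OF X(1,2), of ?f] by blast
  have "?f (j + d) = x [^] j \<otimes> ?f d \<otimes> inv (x [^] j)"
    using car by (simp add: nat_pow_mult[symmetric] inv_mult_group m_assoc)
  then have "u = ?f d"
    using d(3) car by simp
  then have "u \<otimes> x [^] d = ?f d \<otimes> x [^] d" by simp
  then have "x [^] d \<otimes> u = u \<otimes> x [^] d"
    using car by (simp add: m_assoc)
  then have "(x [^] d) [^] (n::nat) \<otimes> u = u \<otimes> (x [^] d) [^] n" for n
    using car group_commutes_pow[of "x [^] d" u n] by simp
  moreover obtain c where "(fact m :: nat) = d * c" using d(2) by (auto simp: dvd_def)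
  ultimately show ?thesis using car by (simp add: nat_pow_pow)
qed

text \<open>
  For \<open>c = [x, y] = x\<^sup>-\<^sup>1 w\<close> and the central element \<open>z = x\<^sup>k = w\<^sup>k\<close>, the element \<open>z\<^sup>n c\<^sup>n = (x\<^sup>k\<^sup>-\<^sup>1 w)\<^sup>n\<close> is a product
  of \<open>k n\<close> elements with \<open>k\<close>-th power \<open>z\<close>. Collecting \<open>k\<close>-th powers turns all but boundedly many factors
  into powers of \<open>z\<close>, and counting factors determines the exponent, so \<open>c\<^sup>n\<close> takes boundedly many values.
\<close>

lemma comm_conj_class_pow:
  assumes "x \<in> X" "y \<in> X"
  shows "comm G x y [^] (fact (num_lists m (fact m * m)) :: nat) = \<one>"
proof -
  define k :: nat where "k = fact m"
  define z where "z = x [^] k"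
  \<comment> \<open>The collection takes place among the elements with the same \<open>k\<close>-th
    power as \<open>x\<close>. Since \<open>z\<close> commutes with \<open>X\<close>, conjugation by
    \<open>X\<close> preserves this set, so it contains \<open>w\<close>.\<close>
  define C where "C = {u \<in> X. u [^] k = z}"
  define w where "w = inv y \<otimes> x \<otimes> y"
  have k: "0 < k" by (simp add: k_def)
  have conj: "inv v \<otimes> u \<otimes> v \<in> X" if "u \<in> X" "v \<in> X" for u v
    using X_conj[OF that(1), of "inv v"] that X(3) by auto
  have car: "x \<in> carrier G" "y \<in> carrier G" "z \<in> carrier G" "w \<in> carrier G"
    using assms X by (auto simp: z_def w_def)
  have zv: "z \<otimes> v = v \<otimes> z" if "v \<in> X" for v
    using conj_class_pow_fact_commute[OF assms(1) that] by (simp add: z_def k_def)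
  have conjC: "inv v \<otimes> u \<otimes> v \<in> C" if "u \<in> C" "v \<in> X" for u v
  proof -
    have uv: "u \<in> carrier G" "v \<in> carrier G" "u \<in> X" "u [^] k = z" using that X by (auto simp: C_def)
    have "(inv v \<otimes> u \<otimes> v) [^] k = inv v \<otimes> (z \<otimes> v)"
      using uv car by (simp only: conj_nat_pow) (simp add: m_assoc)
    also have "\<dots> = z"
      using uv car zv[OF that(2)] by simp
    finally show ?thesis using conj uv that by (simp add: C_def)
  qed
  have xC: "x \<in> C" using assms by (simp add: C_def z_def)
  then have wC: "w \<in> C" unfolding w_def using assms(2) by (rule conjC)
  have C: "finite C" "C \<subseteq> carrier G" "\<And>x y. x \<in> C \<Longrightarrow> y \<in> C \<Longrightarrow> inv y \<otimes> x \<otimes> y \<in> C"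
    using X conjC by (auto simp: C_def)
  have zC: "u [^] k = z" if "u \<in> C" for u
    using that by (simp add: C_def)
  have "card C \<le> m"
    using X card_mono[of X C] by (auto simp: C_def)
  let ?c = "comm G x y"
  have c: "?c = inv x \<otimes> w" using car by (simp add: comm_def w_def m_assoc)
  \<comment> \<open>\<open>?f\<close> recovers the power of the commutator from the shortened word
    alone: this word has length \<open>k * l\<close> with \<open>n = q + l\<close>, so
    \<open>z^q\<close> cancels and only \<open>z^l\<close> is left to divide by.\<close>
  let ?f = "\<lambda>xs. inv (z [^] (length xs div k)) \<otimes> list_prod G xs"
  let ?S = "?f ` {xs. set xs \<subseteq> X \<and> length xs \<le> k * m}"
  have "?c [^] n \<in> ?S" for n :: nat
  proof -
    have zc: "z \<otimes> ?c = x [^] (k - 1) \<otimes> w"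
    proof -
      have "z = x [^] (k - 1) \<otimes> x"
        using k by (metis z_def Suc_diff_1 nat_pow_Suc)
      then show ?thesis using car by (simp add: c m_assoc)
    qed
    have "z \<otimes> inv x = inv x \<otimes> z"
    proof -
      have "inv x \<otimes> (x \<otimes> z) \<otimes> inv x = inv x \<otimes> (z \<otimes> x) \<otimes> inv x"
        using zv[OF assms(1)] by simp
      then show ?thesis using car by (simp add: m_assoc)
    qed
    moreover have "z \<otimes> w = w \<otimes> z" using zv wC by (simp add: C_def)
    ultimately have "z \<otimes> ?c = ?c \<otimes> z"
      unfolding c using car by (metis m_assoc inv_closed)
    then have zcn: "(z \<otimes> ?c) [^] n = z [^] n \<otimes> ?c [^] n"
      using car by (intro pow_mult_distrib) auto
    have "\<exists>xs. set xs \<subseteq> C \<and> length xs = k * n \<and> (z \<otimes> ?c) [^] n = list_prod G xs" for n :: nat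
    proof (induction n)
      case (Suc n)
      then obtain xs where xs: "set xs \<subseteq> C" "length xs = k * n" "(z \<otimes> ?c) [^] n = list_prod G xs"
        by blast
      let ?ys = "replicate (k - 1) x @ [w]"
      have "set xs \<subseteq> carrier G" using xs(1) C(2) by blast
      moreover have ys: "set ?ys \<subseteq> C" using xC wC by auto
      moreover have "set (replicate (k - 1) x) \<subseteq> carrier G" using car by auto
      then have "list_prod G ?ys = z \<otimes> ?c"
        using car by (simp add: zc list_prod_append list_prod_replicate)
      ultimately have "(z \<otimes> ?c) [^] Suc n = list_prod G (xs @ ?ys)"
        using list_prod_append[OF _ subset_trans[OF ys C(2)], of xs] xs(3) by simp
      then show ?case
        using xs ys k by (intro exI[of _ "xs @ ?ys"]) auto
    qed simp
    then obtain xs where xs: "set xs \<subseteq> C" "length xs = k * n" "(z \<otimes> ?c) [^] n = list_prod G xs"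
      by blast
    obtain ys q where ys: "set ys \<subseteq> C" "length ys \<le> k * card C" "length xs = length ys + k * q"
      "list_prod G xs = z [^] q \<otimes> list_prod G ys"
      using list_prod_shorten[OF C k car(3) zC xs(1)] by blast
    define l where "l = length ys div k"
    have "k dvd length ys + k * q" using xs(2) ys(3) by simp
    then have "k dvd length ys" by (metis dvd_add_left_iff dvd_triv_left)
    then have "length ys = k * l" by (simp add: l_def)
    then have "k * n = k * (q + l)" using xs(2) ys(3) by (simp add: distrib_left)
    then have n: "n = q + l" using k by simp
    have yc: "list_prod G ys \<in> carrier G" using ys(1) C(2) by auto
    have "z [^] q \<otimes> (z [^] l \<otimes> ?c [^] n) = z [^] q \<otimes> list_prod G ys"
      using zcn xs(3) ys(4) car by (simp add: n nat_pow_mult flip: m_assoc)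
    then have "z [^] l \<otimes> ?c [^] n = list_prod G ys"
      using car yc by simp
    moreover have "?c [^] n = inv (z [^] l) \<otimes> (z [^] l \<otimes> ?c [^] n)"
      using car by simp
    ultimately have "?c [^] n = ?f ys"
      unfolding l_def[symmetric] by simp
    moreover have "length ys \<le> k * m"
      using ys(2) mult_le_mono2[OF \<open>card C \<le> m\<close>, of k] by (rule le_trans)
    moreover have "set ys \<subseteq> X" using ys(1) by (auto simp: C_def)
    ultimately show ?thesis by blast
  qed
  then show ?thesis
    using car lists_image_bound[OF X(1,2), of ?f "k * m"]
    by (intro nat_pow_fact_eq_one[of _ ?S]) (auto simp: k_def)
qed

text \<open>Dietzmann's lemma applies to the set of at most \<open>m * m\<close> commutators: it is
  closed under conjugation, and \<open>comm_conj_class_pow\<close> gives a common exponent.\<close>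

lemma conj_class_commutators:
  defines "D \<equiv> generate G {comm G x y | x y. x \<in> X \<and> y \<in> X}"
  shows "D \<lhd> G" and "finite D"
    and "card D \<le> num_lists (m * m) (fact (num_lists m (fact m * m)) * (m * m))"
proof -
  let ?Y = "{comm G x y | x y. x \<in> X \<and> y \<in> X}"
  have Y: "?Y = (\<lambda>(x, y). comm G x y) ` (X \<times> X)" by auto
  have Yc: "?Y \<subseteq> carrier G" using X(3) by auto
  have conj: "z \<otimes> h \<otimes> inv z \<in> ?Y" if "h \<in> ?Y" "z \<in> carrier G" for h z
  proof -
    from that obtain x y where xy: "h = comm G x y" "x \<in> X" "y \<in> X" by auto
    then have "z \<otimes> h \<otimes> inv z = comm G (z \<otimes> x \<otimes> inv z) (z \<otimes> y \<otimes> inv z)"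
      using X(3) that by (auto intro: comm_conj)
    then show ?thesis using X_conj xy that by auto
  qed
  show "D \<lhd> G"
    unfolding D_def by (rule normal_generateI[OF Yc conj])
  have fin: "finite ?Y" unfolding Y using X by simp
  have "card ?Y \<le> card (X \<times> X)"
    unfolding Y using X by (intro card_image_le) simp
  also have "\<dots> \<le> m * m"
    using X by (simp add: card_cartesian_product mult_le_mono)
  finally have card: "card ?Y \<le> m * m" .
  have conj': "inv y \<otimes> x \<otimes> y \<in> ?Y" if "x \<in> ?Y" "y \<in> ?Y" for x y
  proof -
    have "y \<in> carrier G" using that Yc by blast
    then show ?thesis using conj[OF that(1), of "inv y"] by simp
  qed
  have pow: "h [^] (fact (num_lists m (fact m * m)) :: nat) = \<one>" if "h \<in> ?Y" for h
    using that comm_conj_class_pow by auto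
  show "finite D" "card D \<le> num_lists (m * m) (fact (num_lists m (fact m * m)) * (m * m))"
    unfolding D_def using dietzmann[OF fin card Yc conj' fact_gt_zero pow] by auto
qed

end

section \<open>Reduction to commuting values in a quotient\<close>

lemma gamma_conj:
  assumes "\<And>p. g p \<in> carrier G" "z \<in> carrier G"
  shows "z \<otimes> gamma G s g \<otimes> inv z = gamma G s (\<lambda>p. z \<otimes> g p \<otimes> inv z)"
proof (induction s)
  case (Suc s)
  then show ?case
    using assms by (cases s) (simp_all add: comm_conj gamma_closed)
qed (use assms in simp)

end

lemma (in group_hom) hom_gamma:
  assumes "\<And>p. g p \<in> carrier G"
  shows "h (gamma G s g) = gamma H s (\<lambda>p. h (g p))"
proof (induction s)
  case (Suc s)
  then show ?case
    using assms by (cases s) (simp_all add: hom_comm G.gamma_closed)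
qed simp

lemma (in group_hom) normal_image:
  assumes "h ` carrier G = carrier H" "K \<lhd> G"
  shows "h ` K \<lhd> H"
proof (rule H.normal_invI)
  show "subgroup (h ` K) H"
    using subgroup_img_is_subgroup[OF normal_imp_subgroup[OF assms(2)]] .
next
  fix x z assume "z \<in> carrier H" "x \<in> h ` K"
  then obtain z' x' where z: "z' \<in> carrier G" "z = h z'" and x: "x' \<in> K" "x = h x'"
    unfolding assms(1)[symmetric] by blast
  then have "z \<otimes>\<^bsub>H\<^esub> x \<otimes>\<^bsub>H\<^esub> inv\<^bsub>H\<^esub> z = h (z' \<otimes> x' \<otimes> inv z')"
    using G.normal_subset[OF assms(2)] by simp
  moreover have "z' \<otimes> x' \<otimes> inv z' \<in> K"
    using normal.inv_op_closed2[OF assms(2) z(1) x(1)] .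
  ultimately show "z \<otimes>\<^bsub>H\<^esub> x \<otimes>\<^bsub>H\<^esub> inv\<^bsub>H\<^esub> z \<in> h ` K" by blast
qed

definition commutator_bound :: "nat \<Rightarrow> nat" where
  "commutator_bound m = num_lists (m * m) (fact (num_lists m (fact m * m)) * (m * m))"

text \<open>The first factor brings a value into the subgroup generated by the commutators of
  values; the second, a factorial of a bound for the order of that subgroup, makes it
  trivial.\<close>

definition gamma_exponent :: "nat \<Rightarrow> nat \<Rightarrow> nat" where
  "gamma_exponent m r = fact m ^ (2 * r * (r - 1) + 1) * fact (commutator_bound m)"

text \<open>In \<open>G Mod D\<close> the values commute, so a bounded power of each value lies in
  the finite group \<open>D\<close> of bounded order. This gives the exponent for Dietzmann's
  lemma.\<close>

lemma (in group) gamma_generate_bound: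
  assumes N: "\<And>p. N p \<lhd> G" and r: "1 \<le> r"
  defines "X \<equiv> {gamma G r g | g. \<forall>p. g p \<in> N p}"
  assumes X: "finite X" "card X \<le> m"
  shows "finite (generate G X)" and "card (generate G X) \<le> num_lists m (gamma_exponent m r * m)"
proof -
  have Nc: "g p \<in> carrier G" if "\<forall>p. g p \<in> N p" for g p
    using that normal_subset[OF N] by blast
  have Xc: "X \<subseteq> carrier G"
    using Nc by (auto simp: X_def intro!: gamma_closed)
  have conj: "z \<otimes> x \<otimes> inv z \<in> X" if x: "x \<in> X" and z: "z \<in> carrier G" for x z
  proof -
    obtain g where g: "x = gamma G r g" "\<forall>p. g p \<in> N p" using x by (auto simp: X_def)
    then have "z \<otimes> x \<otimes> inv z = gamma G r (\<lambda>p. z \<otimes> g p \<otimes> inv z)"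
      using gamma_conj Nc z by simp
    moreover have "z \<otimes> g p \<otimes> inv z \<in> N p" for p
      using normal.inv_op_closed2[OF N z] g(2) by simp
    ultimately show ?thesis by (auto simp: X_def)
  qed
  define D where "D = generate G {comm G x y | x y. x \<in> X \<and> y \<in> X}"
  note D = conj_class_commutators[OF X Xc conj, folded D_def commutator_bound_def]
  interpret \<pi>: group_hom G "G Mod D" "(#>) D" using D(1) by (rule group_hom_Mod)
  have surj: "(#>) D ` carrier G = carrier (G Mod D)"
    by (auto simp: FactGroup_def RCOSETS_def)
  interpret Q: commuting_gamma_values "G Mod D" "\<lambda>p. (#>) D ` N p" r m "(#>) D ` X"
  proof (intro commuting_gamma_values.intro commuting_gamma_values_axioms.intro)
    show "group (G Mod D)" by (rule \<pi>.H.group_axioms)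
    show "(#>) D ` N p \<lhd> G Mod D" for p
      using surj N by (rule \<pi>.normal_image)
    show "finite ((#>) D ` X)" using X by simp
    show "card ((#>) D ` X) \<le> m" using X card_image_le[OF X(1)] le_trans by blast
    show "gamma (G Mod D) r g \<in> (#>) D ` X" if "\<And>p. g p \<in> (#>) D ` N p" for g
    proof -
      have "\<forall>p. \<exists>a. a \<in> N p \<and> g p = D #> a" using that by blast
      then obtain g' where g': "\<forall>p. g' p \<in> N p \<and> g p = D #> g' p" by metis
      then have "g = (\<lambda>p. D #> g' p)" by auto
      then have "gamma (G Mod D) r g = D #> gamma G r g'"
        using \<pi>.hom_gamma[of g'] g' Nc by simp
      then show ?thesis using g' by (auto simp: X_def)
    qed
    show "z \<otimes>\<^bsub>G Mod D\<^esub> x \<otimes>\<^bsub>G Mod D\<^esub> inv\<^bsub>G Mod D\<^esub> z \<in> (#>) D ` X"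
      if "x \<in> (#>) D ` X" "z \<in> carrier (G Mod D)" for x z
    proof -
      obtain x' z' where x': "x' \<in> X" "x = D #> x'" and z': "z' \<in> carrier G" "z = D #> z'"
        using \<open>x \<in> _\<close> \<open>z \<in> _\<close> unfolding surj[symmetric] by blast
      have "x' \<in> carrier G" using x' Xc by auto
      then have "z \<otimes>\<^bsub>G Mod D\<^esub> x \<otimes>\<^bsub>G Mod D\<^esub> inv\<^bsub>G Mod D\<^esub> z = D #> (z' \<otimes> x' \<otimes> inv z')"
        using z'(1) unfolding x'(2) z'(2) by (simp del: mult_FactGroup)
      then show ?thesis using conj[OF x'(1) z'(1)] by blast
    qed
    show "(#>) D ` X \<subseteq> carrier (G Mod D)" using Xc surj by blast
    show "x \<otimes>\<^bsub>G Mod D\<^esub> y = y \<otimes>\<^bsub>G Mod D\<^esub> x" if "x \<in> (#>) D ` X" "y \<in> (#>) D ` X" for x y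
    proof -
      obtain x' y' where xy: "x' \<in> X" "x = D #> x'" "y' \<in> X" "y = D #> y'"
        using \<open>x \<in> _\<close> \<open>y \<in> _\<close> by auto
      then have c: "x' \<in> carrier G" "y' \<in> carrier G" using Xc by auto
      have "comm G x' y' \<in> D"
        unfolding D_def using xy by (intro generate.incl) auto
      then have "comm (G Mod D) x y = \<one>\<^bsub>G Mod D\<^esub>"
        using Mod_eq_one_iff[OF D(1), of "comm G x' y'"] c xy by (simp add: \<pi>.hom_comm)
      then show ?thesis
        using \<pi>.H.comm_eq_one_iff[of x y] c xy by simp
    qed
    show "1 \<le> r" by (rule r)
  qed
  let ?E = "fact m ^ (2 * r * (r - 1) + 1) :: nat"
  have pow: "x [^] gamma_exponent m r = \<one>" if x: "x \<in> X" for x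
  proof -
    obtain g where g: "x = gamma G r g" "\<forall>p. g p \<in> N p" using x by (auto simp: X_def)
    have xc: "x \<in> carrier G" using x Xc by auto
    have "gamma (G Mod D) r (\<lambda>p. D #> g p) [^]\<^bsub>G Mod D\<^esub> ?E = \<one>\<^bsub>G Mod D\<^esub>"
      using g(2) by (intro Q.gamma_pow_eq_one) blast
    then have "D #> x [^] ?E = \<one>\<^bsub>G Mod D\<^esub>"
      using \<pi>.hom_gamma[of g r] \<pi>.hom_nat_pow[of x ?E] Nc[OF g(2)] xc g(1) by simp
    then have "x [^] ?E \<in> D"
      using xc Mod_eq_one_iff[OF D(1), of "x [^] ?E"] by simp
    moreover interpret D: normal D G by (rule D(1))
    have "y [^] j \<in> D" if "y \<in> D" for y and j :: nat
      using that by (induction j) simp_all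
    ultimately have "(x [^] ?E) [^] j \<in> D" for j :: nat by blast
    then have "(x [^] ?E) [^] (fact (commutator_bound m) :: nat) = \<one>"
      using xc D(2,3) by (intro nat_pow_fact_eq_one) auto
    then show ?thesis using xc by (simp add: nat_pow_pow gamma_exponent_def)
  qed
  have "inv y \<otimes> x \<otimes> y \<in> X" if "x \<in> X" "y \<in> X" for x y
    using conj[of x "inv y"] that Xc by auto
  moreover have "0 < gamma_exponent m r" by (simp add: gamma_exponent_def)
  ultimately show "finite (generate G X)" "card (generate G X) \<le> num_lists m (gamma_exponent m r * m)"
    using dietzmann[OF X Xc _ _ pow] by auto
qed

section \<open>Transfer to arbitrary groups\<close>

definition gamma_order_limit :: "nat \<Rightarrow> nat \<Rightarrow> nat" where
  "gamma_order_limit m r = num_lists m (gamma_exponent m r * m)"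

lemma verbal_subgroup_gamma_limit:
  assumes "group G" and r: "1 \<le> r" and N: "\<And>i. i \<in> {1..r} \<Longrightarrow> N i \<lhd> G"
    and fin: "finite (word_values r (gamma G r) N)" "card (word_values r (gamma G r) N) \<le> m"
  shows "finite (verbal_subgroup G r (gamma G r) N) \<and>
    card (verbal_subgroup G r (gamma G r) N) \<le> gamma_order_limit m r"
proof -
  interpret group G by fact
  \<comment> \<open>\<open>gamma_generate_bound\<close> works with tuples indexed by all naturals;
    the whole group fills the positions outside \<open>1..r\<close>, and \<open>\<one>\<close> pads
    the tuples of elements.\<close>
  define N' where "N' p = (if p \<in> {1..r} then N p else carrier G)" for p
  have "N' p \<lhd> G" for p
    using N normal_carrier by (auto simp: N'_def)
  moreover have "word_values r (gamma G r) N = {gamma G r g | g. \<forall>p. g p \<in> N' p}"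
  proof (intro equalityI subsetI)
    fix x assume "x \<in> word_values r (gamma G r) N"
    then obtain g where g: "x = gamma G r g" "\<forall>i\<in>{1..r}. g i \<in> N i"
      by (auto simp: word_values_def)
    let ?g = "\<lambda>p. if p \<in> {1..r} then g p else \<one>\<^bsub>G\<^esub>"
    have "gamma G r g = gamma G r ?g" by (rule gamma_cong) auto
    moreover have "\<forall>p. ?g p \<in> N' p" using g(2) by (auto simp: N'_def)
    ultimately show "x \<in> {gamma G r g | g. \<forall>p. g p \<in> N' p}" using g(1) by blast
  next
    fix x assume "x \<in> {gamma G r g | g. \<forall>p. g p \<in> N' p}"
    then obtain g where g: "x = gamma G r g" "\<forall>p. g p \<in> N' p" by blast
    then have "\<forall>i\<in>{1..r}. g i \<in> N i" unfolding N'_def by metis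
    then show "x \<in> word_values r (gamma G r) N"
      using g(1) by (auto simp: word_values_def)
  qed
  ultimately show ?thesis
    using gamma_generate_bound[of N' r m] r fin
    by (simp add: verbal_subgroup_def gamma_order_limit_def)
qed

text \<open>\<open>gamma_order_limit m r\<close> witnesses that the choice defining
  \<open>gamma_order_bound\<close> succeeds.\<close>

lemma gamma_order_bound_nat:
  fixes G :: "nat monoid"
  assumes "1 \<le> r" "group G" "\<And>i. i \<in> {1..r} \<Longrightarrow> N i \<lhd> G"
    and "finite (word_values r (gamma G r) N)" "card (word_values r (gamma G r) N) = m"
  shows "finite (verbal_subgroup G r (gamma G r) N) \<and>
    card (verbal_subgroup G r (gamma G r) N) \<le> gamma_order_bound m r"
proof -
  let ?P = "\<lambda>b. \<forall>(G :: nat monoid) N.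
     group G \<longrightarrow> (\<forall>i\<in>{1..r}. N i \<lhd> G) \<longrightarrow>
     finite (word_values r (gamma G r) N) \<longrightarrow> card (word_values r (gamma G r) N) = m \<longrightarrow>
       finite (verbal_subgroup G r (gamma G r) N) \<and>
       card (verbal_subgroup G r (gamma G r) N) \<le> b"
  have "?P (gamma_order_limit m r)"
  proof (intro allI impI)
    fix G :: "nat monoid" and N
    assume "group G" "\<forall>i\<in>{1..r}. N i \<lhd> G" "finite (word_values r (gamma G r) N)"
      "card (word_values r (gamma G r) N) = m"
    then show "finite (verbal_subgroup G r (gamma G r) N) \<and>
       card (verbal_subgroup G r (gamma G r) N) \<le> gamma_order_limit m r"
      using \<open>1 \<le> r\<close> by (intro verbal_subgroup_gamma_limit) auto
  qed
  then have "?P (gamma_order_bound m r)"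
    unfolding gamma_order_bound_def by (rule someI[of ?P])
  then show ?thesis using assms by blast
qed

section \<open>Copies of countable subgroups on the natural numbers\<close>

context group
begin

lemma countable_generate:
  assumes "countable S" "S \<subseteq> carrier G"
  shows "countable (generate G S)"
proof -
  let ?T = "S \<union> (\<lambda>x. inv x) ` S"
  have T: "?T \<subseteq> carrier G" using assms(2) by auto
  have "\<exists>xs\<in>lists ?T. x = list_prod G xs" if "x \<in> generate G S" for x
    using that
  proof (induction rule: generate.induct)
    case one
    show ?case by (rule bexI[of _ "[]"]) auto
  next
    case (incl h)
    then show ?case using assms(2) by (intro bexI[of _ "[h]"]) auto
  next
    case (inv h)
    then show ?case using assms(2) by (intro bexI[of _ "[inv h]"]) auto
  next
    case (eng a b)
    then obtain xs ys where xy: "xs \<in> lists ?T" "a = list_prod G xs" "ys \<in> lists ?T" "b = list_prod G ys"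
      by blast
    then have "set xs \<subseteq> carrier G" "set ys \<subseteq> carrier G" using T by (auto simp: in_lists_conv_set)
    then have "a \<otimes> b = list_prod G (xs @ ys)"
      using xy by (simp add: list_prod_append)
    then show ?case using xy by (intro bexI[of _ "xs @ ys"]) simp_all
  qed
  then have "generate G S \<subseteq> list_prod G ` lists ?T" by blast
  moreover have "countable (list_prod G ` lists ?T)"
    using assms(1) by (intro countable_image countable_lists) auto
  ultimately show ?thesis by (rule countable_subset)
qed

text \<open>The operation of \<open>H\<close> is transported along an injection \<open>f\<close>
  into the naturals, and \<open>\<psi>\<close> inverts \<open>f\<close>.\<close>

lemma countable_subgroup_nat_copy:
  assumes "subgroup H G" "countable H"
  obtains K :: "nat monoid" and \<psi> where "group K" "\<psi> \<in> hom K G" "inj_on \<psi> (carrier K)" "\<psi> ` carrier K = H"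
proof -
  interpret H: subgroup H G by fact
  obtain f :: "'a \<Rightarrow> nat" where f: "inj_on f H"
    using assms(2) by (auto simp: countable_def)
  define \<psi> where "\<psi> = inv_into H f"
  have \<psi>f [simp]: "\<psi> (f x) = x" if "x \<in> H" for x
    using that f by (simp add: \<psi>_def)
  define K where "K = \<lparr>carrier = f ` H, mult = (\<lambda>a b. f (\<psi> a \<otimes> \<psi> b)), one = f \<one>\<rparr>"
  have "group K"
  proof (rule groupI)
    fix a assume "a \<in> carrier K"
    then obtain x where "x \<in> H" "a = f x" by (auto simp: K_def)
    then show "\<exists>b\<in>carrier K. b \<otimes>\<^bsub>K\<^esub> a = \<one>\<^bsub>K\<^esub>"
      by (intro bexI[of _ "f (inv x)"]) (auto simp: K_def)
  qed (auto simp: K_def m_assoc)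
  moreover have "\<psi> \<in> hom K G"
    by (auto simp: hom_def K_def)
  moreover have "inj_on \<psi> (carrier K)"
    by (auto simp: inj_on_def K_def)
  moreover have "\<psi> ` carrier K = H"
    by (force simp: K_def image_iff)
  ultimately show ?thesis using that by blast
qed

end

lemma (in group_hom) normal_vimage:
  assumes "K \<lhd> H" shows "{x \<in> carrier G. h x \<in> K} \<lhd> G"
proof -
  interpret K: normal K H by fact
  show ?thesis
  proof (rule G.normal_invI)
    show "subgroup {x \<in> carrier G. h x \<in> K} G"
    proof (rule G.subgroupI)
      have "\<one> \<in> {x \<in> carrier G. h x \<in> K}" by simp
      then show "{x \<in> carrier G. h x \<in> K} \<noteq> {}" by blast
    qed auto
  qed (auto simp: K.inv_op_closed2)
qed

theorem corollary2p12:
  fixes G :: "('a, 'b) monoid_scheme"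
    and N :: "nat \<Rightarrow> 'a set"
    and r m :: nat
  assumes "r \<ge> 1"
    and "group G"
    and "\<And>i. i \<in> {1..r} \<Longrightarrow> N i \<lhd> G"
    and "finite (word_values r (gamma G r) N)"
    and "card (word_values r (gamma G r) N) = m"
  shows "finite (verbal_subgroup G r (gamma G r) N) \<and>
         card (verbal_subgroup G r (gamma G r) N) \<le> gamma_order_bound m r"
proof -
  interpret group G by fact
  let ?X = "word_values r (gamma G r) N"
  have "\<forall>x\<in>?X. \<exists>g. x = gamma G r g \<and> (\<forall>i\<in>{1..r}. g i \<in> N i)"
    by (auto simp: word_values_def)
  then obtain g where g: "\<And>x. x \<in> ?X \<Longrightarrow> x = gamma G r (g x)"
    "\<And>x i. x \<in> ?X \<Longrightarrow> i \<in> {1..r} \<Longrightarrow> g x i \<in> N i"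
    by metis
  \<comment> \<open>One tuple is kept for each of the finitely many values, so \<open>?S\<close> is
    finite.\<close>
  let ?S = "\<Union>x\<in>?X. g x ` {1..r}"
  have S: "?S \<subseteq> carrier G"
    using g(2) normal_subset[OF assms(3)] by blast
  have "countable ?S"
    using assms(4) by (intro countable_finite) auto
  then obtain K :: "nat monoid" and \<psi> where K: "group K" and \<psi>: "\<psi> \<in> hom K G"
    and inj: "inj_on \<psi> (carrier K)" and img: "\<psi> ` carrier K = generate G ?S"
    using countable_subgroup_nat_copy[OF generate_is_subgroup[OF S] countable_generate[OF _ S]] by blast
  interpret \<psi>: group_hom K G \<psi>
    using K \<psi> by (simp add: group_hom_def group_hom_axioms_def group_axioms)
  \<comment> \<open>Under \<open>\<psi>\<close> this corresponds to the intersection of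
    \<open>N i\<close> with the subgroup generated by \<open>?S\<close>.\<close>
  define M where "M i = {a \<in> carrier K. \<psi> a \<in> N i}" for i
  have M: "M i \<lhd> K" if "i \<in> {1..r}" for i
    unfolding M_def using assms(3)[OF that] by (rule \<psi>.normal_vimage)
  let ?Y = "word_values r (gamma K r) M"
  have hom: "gamma K r h \<in> carrier K \<and> \<psi> (gamma K r h) = gamma G r (\<lambda>i. \<psi> (h i))"
    if "\<And>i. i \<in> {1..r} \<Longrightarrow> h i \<in> carrier K" for h
  proof -
    let ?h = "\<lambda>i. if i \<in> {1..r} then h i else \<one>\<^bsub>K\<^esub>"
    have h: "?h i \<in> carrier K" for i using that by simp
    have "gamma K r h = gamma K r ?h" "gamma G r (\<lambda>i. \<psi> (h i)) = gamma G r (\<lambda>i. \<psi> (?h i))"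
      by (rule gamma_cong; simp)+
    then show ?thesis
      using \<psi>.hom_gamma[of ?h r] \<psi>.G.gamma_closed[of ?h r] h by simp
  qed
  have Y: "?Y \<subseteq> carrier K"
    using hom by (auto simp: word_values_def M_def)
  have "\<psi> ` ?Y = ?X"
  proof (intro equalityI subsetI)
    fix x assume "x \<in> \<psi> ` ?Y"
    then obtain h where h: "x = \<psi> (gamma K r h)" "\<And>i. i \<in> {1..r} \<Longrightarrow> h i \<in> M i"
      by (auto simp: word_values_def)
    then have "x = gamma G r (\<lambda>i. \<psi> (h i))"
      using hom[of h] by (auto simp: M_def)
    then show "x \<in> ?X"
      using h(2) by (auto simp: word_values_def M_def)
  next
    fix x assume x: "x \<in> ?X"
    \<comment> \<open>The tuple kept for \<open>x\<close> has its entries in the image of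
      \<open>\<psi>\<close>, so it lifts to \<open>K\<close> and no value is lost.\<close>
    have "\<exists>a. a \<in> carrier K \<and> \<psi> a = g x i" if "i \<in> {1..r}" for i
    proof -
      have "g x i \<in> generate G ?S"
        using x that by (intro generate.incl) blast
      then show ?thesis unfolding img[symmetric] by auto
    qed
    then obtain h where h: "\<And>i. i \<in> {1..r} \<Longrightarrow> h i \<in> carrier K \<and> \<psi> (h i) = g x i"
      by metis
    have "gamma G r (\<lambda>i. \<psi> (h i)) = gamma G r (g x)"
      using h by (intro gamma_cong) blast
    then have "x = \<psi> (gamma K r h)"
      using hom[of h] h g(1)[OF x] by simp
    moreover have "gamma K r h \<in> ?Y"
      using h g(2)[OF x] by (auto simp: word_values_def M_def)
    ultimately show "x \<in> \<psi> ` ?Y" by blast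
  qed
  \<comment> \<open>The bound for \<open>K\<close> is stated for exactly \<open>m\<close> values, so
    the number of values must be preserved.\<close>
  moreover have injY: "inj_on \<psi> ?Y" using inj Y by (rule inj_on_subset)
  ultimately have "finite ?Y" "card ?Y = m"
    using assms(4,5) finite_imageD[of \<psi> ?Y] card_image[of \<psi> ?Y] by simp_all
  then have bound: "finite (verbal_subgroup K r (gamma K r) M)"
    "card (verbal_subgroup K r (gamma K r) M) \<le> gamma_order_bound m r"
    using gamma_order_bound_nat[OF assms(1) K M] by simp_all
  have "verbal_subgroup G r (gamma G r) N = \<psi> ` verbal_subgroup K r (gamma K r) M"
    using \<psi>.generate_img[OF Y] \<open>\<psi> ` ?Y = ?X\<close> by (simp add: verbal_subgroup_def)
  then show ?thesis
    using bound card_image_le[OF bound(1), of \<psi>] by simp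
qed

end
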